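(* Let $f_0\in H_3^1\cup H_3^4$ and $\tau=0$. Then, in those coordinates in which the local map $T_0$ takes the second-order normal form, the value of $$s_0=dx^+(ac+f_{20}x^+)+\tfrac12f_{11}x^+\left(1+\nu_1-\tfrac12f_{11}x^+\right),\qquad \nu_1=-bc,$$ does not depend on the choice of the pair $(M^+,M^-)$ of homoclinic points of the orbit $\Gamma_0$.
   Context: Setting. $f_0$ is a $C^r$-smooth ($r\ge3$, and $r$ large enough that the second-order normal-form coordinates below exist) area-preserving map of a surface (Jacobian $\pm1$) such that: $f_0$ has a saddle fixed (or periodic) point $O$ with multipliers $\lambda,\gamma$, $0<|\lambda|<1<|\gamma|$, $|\lambda\gamma|=1$; the stable and unstable manifolds of $O$ have a quadratic tangency at the points of a homoclinic orbit $\Gamma_0$. $U_0$ is a small disk containing $O$. Local map: $T_0=f_0|_{U_0}$; second-order normal form (here $\lambda\gamma=1$): $\bar x=\lambda x(1+\beta_1xy+\beta_2(xy)^2)+O[|x|^3|y|^2(|x|+|y|)]$, $\bar y=\gamma y(1-\beta_1xy+\tilde\beta_2(xy)^2)+O[|x|^2|y|^3(|x|+|y|)]$, $\tilde\beta_2=\beta_1^2-\beta_2$. For a pair of points $M^+=(x^+,0)\in W^s_{loc}$ and $M^-=(0,y^-)\in W^u_{loc}$ of $\Gamma_0$ in $U_0$ with $f_0^q(M^-)=M^+$ (coordinates normalised by sign changes so that $x^+>0$, $y^->0$), the global map is $T_1=f_0^q$ from a small neighbourhood of $M^-$ to a small neighbourhood of $M^+$, written as $\bar x-x^+=ax+b(y-y^-)+e_{20}x^2+e_{11}x(y-y^-)+e_{02}(y-y^-)^2+\dots$,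 $\bar y=cx+d(y-y^-)^2+f_{20}x^2+f_{11}x(y-y^-)+\dots$, with $d\ne0$, $|bc|=1$. This defines the coefficients $a,b,c,d,f_{20},f_{11}$ and $x^+,y^-$ for the given pair. Changing the pair means replacing $(M^+,M^-)$ by another pair of points of $\Gamma_0$ in $W^s_{loc}$ and $W^u_{loc}$ (images of $M^\pm$ under iterates of $T_0^{\pm1}$), with $T_1$ changed accordingly. $H_3^1$: $\lambda=\gamma^{-1}>0$, $c>0$ (with $d>0$ taken for definiteness); $H_3^4$: $\lambda=\gamma^{-1}<0$, $c>0$, $d>0$. $\tau=\frac1{\ln|\lambda|}\ln\left|\frac{cx^+}{y^-}\right|$. *)

theory Defs
  imports "HOL-Analysis.Analysis" "HOL-Library.Landau_Symbols"
begin

subsection \<open>Surfaces with an area, and area-preserving maps\<close>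

fun Ck_on :: "nat \<Rightarrow> 'a::euclidean_space set \<Rightarrow> ('a \<Rightarrow> 'b::real_normed_vector) \<Rightarrow> bool" where
  "Ck_on 0 S g \<longleftrightarrow> continuous_on S g"
| "Ck_on (Suc n) S g \<longleftrightarrow>
     (\<forall>x\<in>S. g differentiable (at x)) \<and> (\<forall>v. Ck_on n S (\<lambda>x. frechet_derivative g (at x) v))"

type_synonym 'a chart = "'a set \<times> ('a \<Rightarrow> real^2)"

definition is_chart :: "'a::topological_space chart \<Rightarrow> bool" where
  "is_chart c \<longleftrightarrow> (case c of (U, \<phi>) \<Rightarrow>
     open U \<and> open (\<phi> ` U) \<and> homeomorphism U (\<phi> ` U) \<phi> (inv_into U \<phi>))"

definition in_charts :: "('a \<Rightarrow> 'a) \<Rightarrow> 'a chart \<Rightarrow> 'a chart \<Rightarrow> real^2 \<Rightarrow> real^2" where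
  "in_charts f c d = snd d \<circ> f \<circ> inv_into (fst c) (snd c)"

definition area_Ck_in_charts :: "nat \<Rightarrow> ('a \<Rightarrow> 'a) \<Rightarrow> 'a chart \<Rightarrow> 'a chart \<Rightarrow> bool" where
  "area_Ck_in_charts k f c d \<longleftrightarrow>
     (let D = snd c ` (fst c \<inter> f -` fst d) in
       Ck_on k D (in_charts f c d) \<and>
       (\<forall>z\<in>D. \<bar>det (matrix (frechet_derivative (in_charts f c d) (at z)))\<bar> = 1))"

definition compatible :: "nat \<Rightarrow> 'a chart \<Rightarrow> 'a chart \<Rightarrow> bool" where
  "compatible k c d \<longleftrightarrow> area_Ck_in_charts k id c d \<and> area_Ck_in_charts k id d c"

text \<open>
  A surface with an area is given by an atlas of coordinates in which the area is the standard
  one \<open>dx dy\<close>: all changes of coordinates have Jacobian \<open>1\<close> or \<open>-1\<close>.  In such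
  coordinates "area-preserving" means literally "Jacobian \<open>1\<close> or \<open>-1\<close>".
\<close>

definition area_atlas :: "nat \<Rightarrow> 'a::topological_space chart set \<Rightarrow> bool" where
  "area_atlas r A \<longleftrightarrow>
     (\<forall>c\<in>A. is_chart c) \<and> (\<Union>c\<in>A. fst c) = UNIV \<and> (\<forall>c\<in>A. \<forall>d\<in>A. compatible r c d)"

definition area_chart ::
  "nat \<Rightarrow> 'a::topological_space chart set \<Rightarrow> 'a chart \<Rightarrow> bool" where
  "area_chart k A c \<longleftrightarrow> is_chart c \<and> (\<forall>d\<in>A. compatible k c d)"

definition area_preserving_map ::
  "nat \<Rightarrow> 'a::topological_space chart set \<Rightarrow> ('a \<Rightarrow> 'a) \<Rightarrow> bool" where
  "area_preserving_map r A f \<longleftrightarrow>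
     bij f \<and> continuous_on UNIV f \<and> (\<forall>c\<in>A. \<forall>d\<in>A. area_Ck_in_charts r f c d)"

subsection \<open>The saddle and the homoclinic orbit\<close>

definition periodic_point :: "('a \<Rightarrow> 'a) \<Rightarrow> nat \<Rightarrow> 'a \<Rightarrow> bool" where
  "periodic_point f p P \<longleftrightarrow>
     p > 0 \<and> (f ^^ p) P = P \<and> (\<forall>j. 0 < j \<and> j < p \<longrightarrow> (f ^^ j) P \<noteq> P)"

definition eigval :: "(real^2 \<Rightarrow> real^2) \<Rightarrow> real \<Rightarrow> bool" where
  "eigval L \<mu> \<longleftrightarrow> (\<exists>v. v \<noteq> 0 \<and> L v = \<mu> *\<^sub>R v)"

definition saddle_fixed_point ::
  "'a chart set \<Rightarrow> ('a \<Rightarrow> 'a) \<Rightarrow> 'a \<Rightarrow> real \<Rightarrow> real \<Rightarrow> bool" where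
  "saddle_fixed_point A T P lam gam \<longleftrightarrow>
     T P = P \<and> 0 < \<bar>lam\<bar> \<and> \<bar>lam\<bar> < 1 \<and> 1 < \<bar>gam\<bar> \<and> \<bar>lam * gam\<bar> = 1 \<and>
     (\<forall>c\<in>A. P \<in> fst c \<longrightarrow>
        (let L = frechet_derivative (in_charts T c c) (at (snd c P)) in eigval L lam \<and> eigval L gam))"

definition stable_set :: "('a::topological_space \<Rightarrow> 'a) \<Rightarrow> 'a \<Rightarrow> 'a set" where
  "stable_set T P = {z. (\<lambda>n. (T ^^ n) z) \<longlonglongrightarrow> P}"

definition unstable_set :: "('a::topological_space \<Rightarrow> 'a) \<Rightarrow> 'a \<Rightarrow> 'a set" where
  "unstable_set T P = stable_set (inv T) P"

definition local_stable_set :: "('a::topological_space \<Rightarrow> 'a) \<Rightarrow> 'a set \<Rightarrow> 'a \<Rightarrow> 'a set" where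
  "local_stable_set T U P = {z \<in> stable_set T P. \<forall>n. (T ^^ n) z \<in> U}"

definition local_unstable_set :: "('a::topological_space \<Rightarrow> 'a) \<Rightarrow> 'a set \<Rightarrow> 'a \<Rightarrow> 'a set" where
  "local_unstable_set T U P = local_stable_set (inv T) U P"

definition full_orbit :: "('a \<Rightarrow> 'a) \<Rightarrow> 'a \<Rightarrow> 'a set" where
  "full_orbit f M = (\<Union>n. {(f ^^ n) M, (inv f ^^ n) M})"

text \<open>
  In suitable coordinates at \<open>M\<close> an arc of \<open>W1\<close> is the first axis and an arc of
  \<open>W2\<close> is a graph over it with a contact of order exactly two.  (For injectively immersed
  curves \<open>W1\<close>, \<open>W2\<close>, an embedded arc contained in the curve is a piece of the curve, so
  that inclusion of the arcs suffices.)
\<close>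

definition quadratic_tangency ::
  "'a::topological_space chart set \<Rightarrow> 'a set \<Rightarrow> 'a set \<Rightarrow> 'a \<Rightarrow> bool" where
  "quadratic_tangency A W1 W2 M \<longleftrightarrow>
     (\<exists>V \<psi> \<epsilon> (g :: real \<Rightarrow> real).
        area_chart 2 A (V, \<psi>) \<and> M \<in> V \<and> \<psi> M = 0 \<and> \<epsilon> > 0 \<and>
        Ck_on 2 {-\<epsilon><..<\<epsilon>} g \<and> g 0 = 0 \<and> deriv g 0 = 0 \<and> deriv (deriv g) 0 \<noteq> 0 \<and>
        (\<forall>t\<in>{-\<epsilon><..<\<epsilon>}.
           (\<exists>z\<in>V \<inter> W1. \<psi> z = vector [t, 0]) \<and> (\<exists>z\<in>V \<inter> W2. \<psi> z = vector [t, g t])))"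

definition quadratic_homoclinic_orbit ::
  "'a::topological_space chart set \<Rightarrow> ('a \<Rightarrow> 'a) \<Rightarrow> nat \<Rightarrow> 'a \<Rightarrow> 'a set \<Rightarrow> bool" where
  "quadratic_homoclinic_orbit A f p P \<Gamma> \<longleftrightarrow>
     (\<exists>M. M \<noteq> P \<and> M \<in> stable_set (f ^^ p) P \<inter> unstable_set (f ^^ p) P \<and>
          quadratic_tangency A (stable_set (f ^^ p) P) (unstable_set (f ^^ p) P) M \<and>
          \<Gamma> = full_orbit f M)"

subsection \<open>The local map\<close>

definition second_order_normal_form ::
  "('a \<Rightarrow> 'a) \<Rightarrow> 'a \<Rightarrow> 'a set \<Rightarrow> ('a \<Rightarrow> real^2) \<Rightarrow> real \<Rightarrow> real \<Rightarrow> bool" where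
  "second_order_normal_form T P U \<phi> lam gam \<longleftrightarrow>
     P \<in> U \<and> \<phi> P = 0 \<and>
     (\<exists>\<beta>1 \<beta>2 \<beta>2' C. \<beta>2' = \<beta>1\<^sup>2 - \<beta>2 \<and>
       (\<forall>z\<in>U. T z \<in> U \<longrightarrow>
         (let x = \<phi> z $ 1; y = \<phi> z $ 2 in
           \<bar>\<phi> (T z) $ 1 - lam * x * (1 + \<beta>1 * (x * y) + \<beta>2 * (x * y)\<^sup>2)\<bar>
             \<le> C * (\<bar>x\<bar> ^ 3 * \<bar>y\<bar> ^ 2 * (\<bar>x\<bar> + \<bar>y\<bar>)) \<and>
           \<bar>\<phi> (T z) $ 2 - gam * y * (1 - \<beta>1 * (x * y) + \<beta>2' * (x * y)\<^sup>2)\<bar>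
             \<le> C * (\<bar>x\<bar> ^ 2 * \<bar>y\<bar> ^ 3 * (\<bar>x\<bar> + \<bar>y\<bar>)))))"

definition sign_change :: "('a \<Rightarrow> real^2) \<Rightarrow> ('a \<Rightarrow> real^2) \<Rightarrow> bool" where
  "sign_change \<phi> \<phi>' \<longleftrightarrow>
     (\<exists>\<sigma>\<in>{-1, 1}. \<exists>\<tau>\<in>{-1, 1}. \<forall>z. \<phi>' z = vector [\<sigma> * \<phi> z $ 1, \<tau> * \<phi> z $ 2])"

subsection \<open>The global map\<close>

definition homoclinic_pair ::
  "('a::topological_space \<Rightarrow> 'a) \<Rightarrow> nat \<Rightarrow> 'a \<Rightarrow> 'a set \<Rightarrow> 'a set \<Rightarrow> ('a \<Rightarrow> real^2) \<Rightarrow>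
   'a \<Rightarrow> 'a \<Rightarrow> nat \<Rightarrow> real \<Rightarrow> real \<Rightarrow> bool" where
  "homoclinic_pair f p P \<Gamma> U \<phi> Mp Mm q xp ym \<longleftrightarrow>
     Mp \<in> \<Gamma> \<inter> local_stable_set (f ^^ p) U P \<and> Mm \<in> \<Gamma> \<inter> local_unstable_set (f ^^ p) U P \<and>
     (f ^^ q) Mm = Mp \<and>
     \<phi> Mp = vector [xp, 0] \<and> \<phi> Mm = vector [0, ym] \<and> xp > 0 \<and> ym > 0"

record global_coeffs =
  co_a :: real
  co_b :: real
  co_c :: real
  co_d :: real
  co_f20 :: real
  co_f11 :: real

text \<open>
  The Taylor expansion of \<open>F\<close> at \<open>(0, ym)\<close> up to second order.  Below, \<open>h\<close> stands for
  \<open>y - ym\<close>; the second component has no term linear in \<open>h\<close>.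
\<close>

definition global_map_expansion ::
  "(real^2 \<Rightarrow> real^2) \<Rightarrow> real \<Rightarrow> real \<Rightarrow> global_coeffs \<Rightarrow> bool" where
  "global_map_expansion F xp ym k \<longleftrightarrow>
     co_d k \<noteq> 0 \<and> \<bar>co_b k * co_c k\<bar> = 1 \<and>
     (\<exists>e20 e11 e02.
       (\<lambda>(x, h). F (vector [x, ym + h]) $ 1 - xp
          - (co_a k * x + co_b k * h + e20 * x\<^sup>2 + e11 * x * h + e02 * h\<^sup>2))
       \<in> o[at (0, 0)](\<lambda>(x, h). x\<^sup>2 + h\<^sup>2)) \<and>
     (\<lambda>(x, h). F (vector [x, ym + h]) $ 2
          - (co_c k * x + co_d k * h\<^sup>2 + co_f20 k * x\<^sup>2 + co_f11 k * x * h))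
       \<in> o[at (0, 0)](\<lambda>(x, h). x\<^sup>2 + h\<^sup>2)"

text \<open>
  A pair \<open>Mp\<close>, \<open>Mm\<close> of points of \<open>\<Gamma>\<close>, the coordinates obtained from \<open>\<phi>\<close> by the
  sign changes that make \<open>xp\<close> and \<open>ym\<close> positive, and the coefficients \<open>k\<close> of the
  map \<open>f ^^ q\<close> from a neighbourhood of \<open>Mm\<close> to one of \<open>Mp\<close> in these coordinates.
\<close>

definition pair_data ::
  "('a::topological_space \<Rightarrow> 'a) \<Rightarrow> nat \<Rightarrow> 'a \<Rightarrow> 'a set \<Rightarrow> 'a set \<Rightarrow> ('a \<Rightarrow> real^2) \<Rightarrow>
   'a \<Rightarrow> 'a \<Rightarrow> real \<Rightarrow> real \<Rightarrow> global_coeffs \<Rightarrow> bool" where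
  "pair_data f p P \<Gamma> U \<phi> Mp Mm xp ym k \<longleftrightarrow>
     (\<exists>\<phi>' q. sign_change \<phi> \<phi>' \<and> homoclinic_pair f p P \<Gamma> U \<phi>' Mp Mm q xp ym \<and>
        global_map_expansion (in_charts (f ^^ q) (U, \<phi>') (U, \<phi>')) xp ym k)"

subsection \<open>The classes and the invariants\<close>

definition class_H31 :: "real \<Rightarrow> real \<Rightarrow> global_coeffs \<Rightarrow> bool" where
  "class_H31 lam gam k \<longleftrightarrow> lam = inverse gam \<and> lam > 0 \<and> co_c k > 0"

definition class_H34 :: "real \<Rightarrow> real \<Rightarrow> global_coeffs \<Rightarrow> bool" where
  "class_H34 lam gam k \<longleftrightarrow> lam = inverse gam \<and> lam < 0 \<and> co_c k > 0 \<and> co_d k > 0"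

definition tau :: "real \<Rightarrow> real \<Rightarrow> real \<Rightarrow> global_coeffs \<Rightarrow> real" where
  "tau lam xp ym k = 1 / ln \<bar>lam\<bar> * ln \<bar>co_c k * xp / ym\<bar>"

definition s0 :: "real \<Rightarrow> global_coeffs \<Rightarrow> real" where
  "s0 xp k = (let \<nu>1 = - co_b k * co_c k in
     co_d k * xp * (co_a k * co_c k + co_f20 k * xp)
     + 1/2 * co_f11 k * xp * (1 + \<nu>1 - 1/2 * co_f11 k * xp))"

end

theory Submission
  imports Defs
begin

text \<open>
  Replacing the pair \<open>(M\<^sup>+, M\<^sup>-)\<close> by another one replaces the global map \<open>T\<^sub>1\<close> by
  \<open>T\<^sub>0\<^sup>i T\<^sub>1 T\<^sub>0\<^sup>j\<close>, so the question is how the quadratic Taylor polynomial of \<open>T\<^sub>1\<close> reacts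
  to one factor \<open>T\<^sub>0\<close> on either side.  Near the stable axis the normal form is, up to terms that
  do not influence the coefficients in \<open>s\<^sub>0\<close>,
  \<open>(x, y) \<mapsto> (\<lambda>(x + \<beta>\<^sub>1 x\<^sup>2 y), \<gamma>(y - \<beta>\<^sub>1 x y\<^sup>2))\<close>, and near the unstable axis it is the same map
  with the two coordinates exchanged and \<open>\<beta>\<^sub>1\<close> replaced by \<open>-\<beta>\<^sub>1\<close>
  (\<open>normal_form_along_first_axis\<close>).  This gives explicit transformation rules for the
  coefficients (\<open>jet_post\<close>, \<open>jet_pre\<close>).

  Because \<open>\<lambda>\<gamma> = 1\<close>, a factor on the left leaves \<open>s\<^sub>0\<close> unchanged: the contributions of
  \<open>\<beta>\<^sub>1\<close> to \<open>ac\<close> and to \<open>f\<^sub>2\<^sub>0 x\<^sup>+\<close> cancel.  A factor on the right changes \<open>s\<^sub>0\<close> by a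
  multiple of \<open>c x\<^sup>+ - y\<^sup>-\<close>.  For positive \<open>c\<close>, \<open>x\<^sup>+\<close>, \<open>y\<^sup>-\<close> the condition \<open>\<tau> = 0\<close>
  says that this difference is zero, and the equation \<open>c x\<^sup>+ = y\<^sup>-\<close> itself survives both kinds
  of step.  Both \<open>s\<^sub>0\<close> and this equation are insensitive to changes of sign of the coordinates, so
  the whole computation can be made in the given chart, with \<open>x\<^sup>+\<close> and \<open>y\<^sup>-\<close> of either sign;
  this treats \<open>\<lambda> > 0\<close> and \<open>\<lambda> < 0\<close> together.

  Two pairs are compared through a third one, obtained by moving \<open>M\<^sup>+\<close> forward and \<open>M\<^sup>-\<close> backward
  along the orbit until the two pairs meet (\<open>point_jet_transport\<close>).  Only factors \<open>T\<^sub>0\<close>, never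
  \<open>T\<^sub>0\<^sup>-\<^sup>1\<close>, are then composed with the global maps.  The orbit is homoclinic, hence not periodic, so
  the two global maps between the common points are the same iterate of \<open>f\<close>, and
  their quadratic Taylor coefficients agree (\<open>point_jet_unique\<close>).
\<close>

section \<open>Products of small quantities\<close>

lemma smallo_of_factor_tendsto_0:
  fixes f g m :: "'z \<Rightarrow> real"
  assumes "\<forall>\<^sub>F z in G. \<bar>f z\<bar> \<le> m z * \<bar>g z\<bar>" and "(m \<longlongrightarrow> 0) G"
  shows "f \<in> o[G](g)"
proof (rule landau_o.smallI)
  fix e :: real assume "e > 0"
  with assms(2) have "\<forall>\<^sub>F z in G. m z < e" by (rule order_tendstoD)
  with assms(1) show "\<forall>\<^sub>F z in G. norm (f z) \<le> e * norm (g z)"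
  proof eventually_elim
    case (elim z)
    have "m z * \<bar>g z\<bar> \<le> e * \<bar>g z\<bar>" using elim by (intro mult_right_mono) auto
    with elim show ?case by simp
  qed
qed

lemma tendsto_0_mult_smallo:
  fixes g m :: "'z \<Rightarrow> real"
  assumes "(m \<longlongrightarrow> 0) G"
  shows "(\<lambda>z. m z * g z) \<in> o[G](g)"
  by (rule smallo_of_factor_tendsto_0[where m = "\<lambda>z. \<bar>m z\<bar>"])
     (use assms tendsto_rabs_zero in \<open>auto simp: abs_mult\<close>)

lemma cmult_smallo: "(f :: 'z \<Rightarrow> real) \<in> o[G](r) \<Longrightarrow> (\<lambda>z. e * f z) \<in> o[G](r)"
  by (cases "e = 0") auto

lemma cmult_bigo: "(f :: 'z \<Rightarrow> real) \<in> O[G](r) \<Longrightarrow> (\<lambda>z. e * f z) \<in> O[G](r)"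
  by (cases "e = 0") auto

lemma product_smallo_radius:
  fixes r u v :: "'z \<Rightarrow> real"
  assumes r: "(r \<longlongrightarrow> 0) G" and u: "u \<in> O[G](r)" and v: "v \<in> O[G](r)"
  shows "(\<lambda>z. u z * v z) \<in> o[G](r)"
  using landau_o.big_mult[OF u v] tendsto_0_mult_smallo[OF r] by (rule landau_o.big_small_trans)

lemma square_smallo_radius:
  fixes r :: "'z \<Rightarrow> real"
  assumes "(r \<longlongrightarrow> 0) G"
  shows "(\<lambda>z. (r z)\<^sup>2) \<in> o[G](r)"
  unfolding power2_eq_square using assms by (rule tendsto_0_mult_smallo)

text \<open>
  Substituting first-order approximations into a quadratic monomial is exact to second order;
  this is how all quadratic terms below are composed.
\<close>

lemma smallo_product_perturbation:
  fixes u u0 v v0 r :: "'z \<Rightarrow> real"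
  assumes u: "(\<lambda>z. u z - u0 z) \<in> o[G](r)" and v: "(\<lambda>z. v z - v0 z) \<in> o[G](r)"
    and u0: "u0 \<in> O[G](r)" and v0: "v0 \<in> O[G](r)"
  shows "(\<lambda>z. u z * v z - u0 z * v0 z) \<in> o[G](\<lambda>z. (r z)\<^sup>2)"
proof -
  have "(\<lambda>z. (u z - u0 z) * (v z - v0 z) + (u z - u0 z) * v0 z + u0 z * (v z - v0 z))
      \<in> o[G](\<lambda>z. r z * r z)"
    by (intro sum_in_smallo landau_o.small_mult landau_o.small_big_mult landau_o.big_small_mult assms)
  thus ?thesis by (simp add: algebra_simps power2_eq_square)
qed

lemma linear_smallo_imp_zero:
  fixes p :: real
  assumes "(\<lambda>t. p * t) \<in> o[at 0](\<lambda>t. t)"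
  shows "p = 0"
proof -
  have "((\<lambda>t. p * t / t) \<longlongrightarrow> 0) (at 0)" using smalloD_tendsto[OF assms] .
  moreover have "\<forall>\<^sub>F t in at (0::real). p * t / t = p"
    by (auto simp: eventually_at_filter)
  ultimately have "((\<lambda>t::real. p) \<longlongrightarrow> 0) (at 0)" by (rule Lim_transform_eventually)
  thus ?thesis by (simp add: tendsto_const_iff)
qed

lemma quadratic_smallo_imp_zero:
  fixes p q :: real
  assumes *: "(\<lambda>t. p * t + q * t\<^sup>2) \<in> o[at 0](\<lambda>t. t\<^sup>2)"
  shows "p = 0" and "q = 0"
proof -
  have small: "(\<lambda>t::real. t\<^sup>2) \<in> o[at 0](\<lambda>t. t)"
    by (rule square_smallo_radius) (rule tendsto_ident_at)
  have "(\<lambda>t. (p * t + q * t\<^sup>2) - q * t\<^sup>2) \<in> o[at 0](\<lambda>t. t)"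
    by (intro sum_in_smallo cmult_smallo small landau_o.small_trans[OF * small])
  thus p: "p = 0" by (intro linear_smallo_imp_zero) simp
  have "((\<lambda>t. q * t\<^sup>2 / t\<^sup>2) \<longlongrightarrow> 0) (at 0)" using smalloD_tendsto[OF *] by (simp add: p)
  moreover have "\<forall>\<^sub>F t in at (0::real). q * t\<^sup>2 / t\<^sup>2 = q"
    by (auto simp: eventually_at_filter)
  ultimately have "((\<lambda>t::real. q) \<longlongrightarrow> 0) (at 0)" by (rule Lim_transform_eventually)
  thus "q = 0" by (simp add: tendsto_const_iff)
qed

section \<open>The normal form along the coordinate axes\<close>

text \<open>
  The estimates of the second-order normal form for one point \<open>(x, y)\<close> and its image
  \<open>(x', y')\<close>, as a relation between four numbers, so that exchanging the coordinates is an
  exchange of arguments.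
\<close>

definition normal_form_bounds :: "real \<Rightarrow> real \<Rightarrow> real \<Rightarrow> real \<Rightarrow> real \<Rightarrow> real \<Rightarrow>
    real \<Rightarrow> real \<Rightarrow> real \<Rightarrow> real \<Rightarrow> bool" where
  "normal_form_bounds lam gam \<beta>1 \<beta>2 \<beta>2' C x y x' y' \<longleftrightarrow>
     \<bar>x' - lam * x * (1 + \<beta>1 * (x * y) + \<beta>2 * (x * y)\<^sup>2)\<bar>
             \<le> C * (\<bar>x\<bar> ^ 3 * \<bar>y\<bar> ^ 2 * (\<bar>x\<bar> + \<bar>y\<bar>)) \<and>
     \<bar>y' - gam * y * (1 - \<beta>1 * (x * y) + \<beta>2' * (x * y)\<^sup>2)\<bar>
             \<le> C * (\<bar>x\<bar> ^ 2 * \<bar>y\<bar> ^ 3 * (\<bar>x\<bar> + \<bar>y\<bar>))"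

lemma normal_form_bounds_swap:
  "normal_form_bounds lam gam \<beta>1 \<beta>2 \<beta>2' C x y x' y' \<longleftrightarrow> normal_form_bounds gam lam (-\<beta>1) \<beta>2' \<beta>2 C y x y' x'"
  by (auto simp: normal_form_bounds_def mult.commute mult.left_commute add.commute)

text \<open>
  Near a point \<open>(x0, 0)\<close> the remainder of the normal form contains a factor \<open>y\<^sup>2\<close> in the first
  and \<open>y\<^sup>3\<close> in the second component, so one order of it can be spent as a factor that tends to
  zero.  The terms with \<open>\<beta>2\<close> and \<open>\<beta>2'\<close> are negligible for the same reason.  \<open>Y'\<close>
  is expanded to second order in \<open>Y\<close> and \<open>X'\<close> only to first: that is the precision with which
  they enter the jets below.
\<close>

lemma normal_form_along_first_axis:
  fixes X Y X' Y' :: "'z \<Rightarrow> real"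
  assumes nf: "\<forall>\<^sub>F z in G. normal_form_bounds lam gam \<beta>1 \<beta>2 \<beta>2' C (X z) (Y z) (X' z) (Y' z)"
    and X: "(X \<longlongrightarrow> x0) G" and Y: "(Y \<longlongrightarrow> 0) G"
  shows "(\<lambda>z. X' z - lam * (X z + \<beta>1 * x0\<^sup>2 * Y z)) \<in> o[G](Y)"
    and "(\<lambda>z. Y' z - gam * (Y z - \<beta>1 * x0 * (Y z)\<^sup>2)) \<in> o[G](\<lambda>z. (Y z)\<^sup>2)"
proof -
  define E1 where "E1 z = X' z - lam * X z * (1 + \<beta>1 * (X z * Y z) + \<beta>2 * (X z * Y z)\<^sup>2)" for z
  define E2 where "E2 z = Y' z - gam * Y z * (1 - \<beta>1 * (X z * Y z) + \<beta>2' * (X z * Y z)\<^sup>2)" for z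
  have "((\<lambda>z. C * (\<bar>X z\<bar>^3 * \<bar>Y z\<bar> * (\<bar>X z\<bar> + \<bar>Y z\<bar>))) \<longlongrightarrow> C * (\<bar>x0\<bar>^3 * \<bar>0\<bar> * (\<bar>x0\<bar> + \<bar>0\<bar>))) G"
    by (intro tendsto_intros X Y)
  hence m1: "((\<lambda>z. C * (\<bar>X z\<bar>^3 * \<bar>Y z\<bar> * (\<bar>X z\<bar> + \<bar>Y z\<bar>))) \<longlongrightarrow> 0) G" by simp
  have "((\<lambda>z. C * (\<bar>X z\<bar>^2 * \<bar>Y z\<bar> * (\<bar>X z\<bar> + \<bar>Y z\<bar>))) \<longlongrightarrow> C * (\<bar>x0\<bar>^2 * \<bar>0\<bar> * (\<bar>x0\<bar> + \<bar>0\<bar>))) G"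
    by (intro tendsto_intros X Y)
  hence m2: "((\<lambda>z. C * (\<bar>X z\<bar>^2 * \<bar>Y z\<bar> * (\<bar>X z\<bar> + \<bar>Y z\<bar>))) \<longlongrightarrow> 0) G" by simp
  have E1: "E1 \<in> o[G](Y)"
    by (rule smallo_of_factor_tendsto_0[OF _ m1], use nf in eventually_elim)
       (simp add: normal_form_bounds_def E1_def power2_eq_square mult_ac
         del: power2_abs abs_mult_self_eq)
  have E2: "E2 \<in> o[G](\<lambda>z. (Y z)\<^sup>2)"
    by (rule smallo_of_factor_tendsto_0[OF _ m2], use nf in eventually_elim)
       (simp add: normal_form_bounds_def E2_def power2_eq_square power3_eq_cube mult_ac abs_mult
         del: power2_abs abs_mult_self_eq)
  have "((\<lambda>z. lam * (\<beta>1 * ((X z)\<^sup>2 - x0\<^sup>2) + \<beta>2 * (X z)^3 * Y z)) \<longlongrightarrow>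
      lam * (\<beta>1 * (x0\<^sup>2 - x0\<^sup>2) + \<beta>2 * x0^3 * 0)) G"
    by (intro tendsto_intros X Y)
  hence "(\<lambda>z. E1 z + lam * (\<beta>1 * ((X z)\<^sup>2 - x0\<^sup>2) + \<beta>2 * (X z)^3 * Y z) * Y z) \<in> o[G](Y)"
    by (intro sum_in_smallo E1 tendsto_0_mult_smallo) simp
  thus "(\<lambda>z. X' z - lam * (X z + \<beta>1 * x0\<^sup>2 * Y z)) \<in> o[G](Y)"
    by (simp add: E1_def algebra_simps power2_eq_square power3_eq_cube)
  have "((\<lambda>z. gam * (\<beta>1 * (x0 - X z) + \<beta>2' * (X z)^2 * Y z)) \<longlongrightarrow>
      gam * (\<beta>1 * (x0 - x0) + \<beta>2' * x0^2 * 0)) G"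
    by (intro tendsto_intros X Y)
  hence "(\<lambda>z. E2 z + gam * (\<beta>1 * (x0 - X z) + \<beta>2' * (X z)^2 * Y z) * (Y z)\<^sup>2) \<in> o[G](\<lambda>z. (Y z)\<^sup>2)"
    by (intro sum_in_smallo E2 tendsto_0_mult_smallo) simp
  thus "(\<lambda>z. Y' z - gam * (Y z - \<beta>1 * x0 * (Y z)\<^sup>2)) \<in> o[G](\<lambda>z. (Y z)\<^sup>2)"
    by (simp add: E2_def algebra_simps power2_eq_square power3_eq_cube)
qed

section \<open>Quadratic jets and their composition with the local map\<close>

text \<open>
  \<open>x\<close> and \<open>h\<close> are the coordinates of the argument relative to the base point, \<open>r\<close> their size,
  \<open>X\<close> and \<open>Y\<close> those of the value.  The first component is only
  expanded to first order, because the coefficients \<open>e\<close> of its quadratic terms never enter the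
  coefficients recorded here under composition with the local map.
\<close>

definition jet :: "'z filter \<Rightarrow> ('z \<Rightarrow> real) \<Rightarrow> ('z \<Rightarrow> real) \<Rightarrow> ('z \<Rightarrow> real) \<Rightarrow>
    ('z \<Rightarrow> real) \<Rightarrow> ('z \<Rightarrow> real) \<Rightarrow> global_coeffs \<Rightarrow> bool" where
  "jet G r x h X Y k \<longleftrightarrow>
     (\<lambda>z. X z - (co_a k * x z + co_b k * h z)) \<in> o[G](r) \<and>
     (\<lambda>z. Y z - (co_c k * x z + co_d k * (h z)\<^sup>2 + co_f20 k * (x z)\<^sup>2 + co_f11 k * x z * h z))
       \<in> o[G](\<lambda>z. (r z)\<^sup>2)"

text \<open>
  The coefficients of \<open>T\<^sub>0 T\<^sub>1\<close>, where \<open>x0\<close> is the first coordinate of the value at the base point.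
\<close>

definition post_coeffs :: "real \<Rightarrow> real \<Rightarrow> real \<Rightarrow> real \<Rightarrow> global_coeffs \<Rightarrow> global_coeffs" where
  "post_coeffs lam gam \<beta> x0 k =
     \<lparr>co_a = lam * (co_a k + \<beta> * x0\<^sup>2 * co_c k), co_b = lam * co_b k,
      co_c = gam * co_c k, co_d = gam * co_d k,
      co_f20 = gam * (co_f20 k - \<beta> * x0 * (co_c k)\<^sup>2), co_f11 = gam * co_f11 k\<rparr>"

text \<open>
  The coefficients of \<open>T\<^sub>1 T\<^sub>0\<close>, where \<open>y0\<close> is the second coordinate of the new base point, which
  \<open>T\<^sub>0\<close> maps to the old one.
\<close>

definition pre_coeffs :: "real \<Rightarrow> real \<Rightarrow> real \<Rightarrow> real \<Rightarrow> global_coeffs \<Rightarrow> global_coeffs" where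
  "pre_coeffs lam gam \<beta> y0 k =
     \<lparr>co_a = lam * co_a k - gam * \<beta> * y0\<^sup>2 * co_b k, co_b = gam * co_b k,
      co_c = lam * co_c k, co_d = gam\<^sup>2 * co_d k,
      co_f20 = lam\<^sup>2 * co_f20 k + lam * \<beta> * y0 * co_c k
        + (gam * \<beta> * y0\<^sup>2)\<^sup>2 * co_d k - lam * gam * \<beta> * y0\<^sup>2 * co_f11 k,
      co_f11 = lam * gam * co_f11 k - 2 * gam\<^sup>2 * \<beta> * y0\<^sup>2 * co_d k\<rparr>"

lemma jet_bigo:
  assumes "jet G r x h X Y k" and r: "(r \<longlongrightarrow> 0) G" and x: "x \<in> O[G](r)" and h: "h \<in> O[G](r)"
  shows "(\<lambda>z. Y z - co_c k * x z) \<in> o[G](r)" and "Y \<in> O[G](r)"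
proof -
  have cq: "(\<lambda>z. e * (u z * v z)) \<in> o[G](r)" if "u \<in> O[G](r)" "v \<in> O[G](r)" for u v e
    by (intro cmult_smallo product_smallo_radius r that)
  have "(\<lambda>z. Y z - (co_c k * x z + co_d k * (h z)\<^sup>2 + co_f20 k * (x z)\<^sup>2 + co_f11 k * x z * h z))
     \<in> o[G](r)"
    using assms(1) landau_o.small_trans[OF _ square_smallo_radius[OF r]] unfolding jet_def by blast
  from sum_in_smallo(1)[OF sum_in_smallo(1)[OF sum_in_smallo(1)[OF this cq[OF h h, of "co_d k"]]
      cq[OF x x, of "co_f20 k"]] cq[OF x h, of "co_f11 k"]]
  show Yc: "(\<lambda>z. Y z - co_c k * x z) \<in> o[G](r)" by (simp add: power2_eq_square algebra_simps)
  have "(\<lambda>z. co_c k * x z) \<in> O[G](r)" using x by (rule cmult_bigo)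
  from sum_in_bigo(1)[OF landau_o.small_imp_big[OF Yc] this] show "Y \<in> O[G](r)" by simp
qed

text \<open>
  \<open>Y\<close> has size \<open>O(r)\<close> with leading term \<open>c x\<close>, so in the normal form along the first axis
  only \<open>\<beta> x0\<^sup>2 c x\<close> is added to the first component and only \<open>- \<beta> x0 (c x)\<^sup>2\<close> to the second.
\<close>

lemma jet_post:
  assumes j: "jet G r x h X Y k" and r: "(r \<longlongrightarrow> 0) G" and x: "x \<in> O[G](r)" and h: "h \<in> O[G](r)"
    and X': "(\<lambda>z. X' z - lam * (X z + \<beta> * x0\<^sup>2 * Y z)) \<in> o[G](Y)"
    and Y': "(\<lambda>z. Y' z - gam * (Y z - \<beta> * x0 * (Y z)\<^sup>2)) \<in> o[G](\<lambda>z. (Y z)\<^sup>2)"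
  shows "jet G r x h X' Y' (post_coeffs lam gam \<beta> x0 k)"
proof -
  note Yc = jet_bigo(1)[OF j r x h] and Y = jet_bigo(2)[OF j r x h]
  have 1: "(\<lambda>z. X' z - lam * (X z + \<beta> * x0\<^sup>2 * Y z)) \<in> o[G](r)"
    using landau_o.small_big_trans[OF X' Y] .
  have 2: "(\<lambda>z. Y' z - gam * (Y z - \<beta> * x0 * (Y z)\<^sup>2)) \<in> o[G](\<lambda>z. (r z)\<^sup>2)"
    using landau_o.small_big_trans[OF Y'] landau_o.big_power[OF Y] by blast
  have 3: "(\<lambda>z. X z - (co_a k * x z + co_b k * h z)) \<in> o[G](r)"
    and 4: "(\<lambda>z. Y z - (co_c k * x z + co_d k * (h z)\<^sup>2 + co_f20 k * (x z)\<^sup>2 + co_f11 k * x z * h z))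
       \<in> o[G](\<lambda>z. (r z)\<^sup>2)"
    using j by (auto simp: jet_def)
  have 5: "(\<lambda>z. Y z * Y z - (co_c k * x z) * (co_c k * x z)) \<in> o[G](\<lambda>z. (r z)\<^sup>2)"
    by (intro smallo_product_perturbation Yc cmult_bigo x)
  show ?thesis unfolding jet_def post_coeffs_def global_coeffs.simps
    using sum_in_smallo(1)[OF 1 sum_in_smallo(1)[OF cmult_smallo[OF 3, of lam]
          cmult_smallo[OF Yc, of "lam * \<beta> * x0\<^sup>2"]]]
      sum_in_smallo(2)[OF sum_in_smallo(1)[OF 2 cmult_smallo[OF 4, of gam]]
          cmult_smallo[OF 5, of "gam * \<beta> * x0"]]
    by (simp add: algebra_simps power2_eq_square)
qed

text \<open>
  The term \<open>c x\<close> of the second component requires \<open>x\<close> up to second order in the new coordinates,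
  whereas \<open>h\<close> occurs there only in quadratic monomials, for which its linear part suffices.
\<close>

lemma jet_pre:
  assumes j: "jet G r x h X Y k"
    and r': "r \<in> O[G](r')" and x': "x' \<in> O[G](r')" and h': "h' \<in> O[G](r')"
    and x: "(\<lambda>z. x z - lam * (x' z + \<beta> * y0 * (x' z)\<^sup>2)) \<in> o[G](\<lambda>z. (x' z)\<^sup>2)"
    and h: "(\<lambda>z. h z - gam * (h' z - \<beta> * y0\<^sup>2 * x' z)) \<in> o[G](x')"
    and r0: "(r' \<longlongrightarrow> 0) G"
  shows "jet G r' x' h' X Y (pre_coeffs lam gam \<beta> y0 k)"
proof -
  define L where "L z = gam * (h' z - \<beta> * y0\<^sup>2 * x' z)" for z
  have L: "L \<in> O[G](r')"
    unfolding L_def by (intro cmult_bigo sum_in_bigo h' x')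
  have 1: "(\<lambda>z. x z - lam * (x' z + \<beta> * y0 * (x' z)\<^sup>2)) \<in> o[G](\<lambda>z. (r' z)\<^sup>2)"
    using landau_o.small_big_trans[OF x] landau_o.big_power[OF x'] by blast
  have 2: "(\<lambda>z. h z - L z) \<in> o[G](r')"
    using landau_o.small_big_trans[OF h x'] by (simp add: L_def)
  have xx: "(\<lambda>z. (x' z)\<^sup>2) \<in> o[G](r')"
    unfolding power2_eq_square using r0 x' x' by (rule product_smallo_radius)
  from sum_in_smallo(1)[OF landau_o.small_trans[OF 1 square_smallo_radius[OF r0]]
      cmult_smallo[OF xx, of "lam * \<beta> * y0"]]
  have 3: "(\<lambda>z. x z - lam * x' z) \<in> o[G](r')" by (simp add: algebra_simps)
  have lx: "(\<lambda>z. lam * x' z) \<in> O[G](r')" by (intro cmult_bigo x')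
  have 4: "(\<lambda>z. X z - (co_a k * x z + co_b k * h z)) \<in> o[G](r')"
    and 5: "(\<lambda>z. Y z - (co_c k * x z + co_d k * (h z)\<^sup>2 + co_f20 k * (x z)\<^sup>2 + co_f11 k * x z * h z))
       \<in> o[G](\<lambda>z. (r' z)\<^sup>2)"
    using j landau_o.small_big_trans[OF _ r'] landau_o.small_big_trans[OF _ landau_o.big_power[OF r']]
    unfolding jet_def by blast+
  note hh = smallo_product_perturbation[OF 2 2 L L]
  note xx = smallo_product_perturbation[OF 3 3 lx lx]
  note xh = smallo_product_perturbation[OF 3 2 lx L]
  have "(\<lambda>z. (X z - (co_a k * x z + co_b k * h z)) + co_a k * (x z - lam * x' z) + co_b k * (h z - L z))
     \<in> o[G](r')"
    by (intro sum_in_smallo cmult_smallo 2 3 4)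
  moreover have "(\<lambda>z. (Y z - (co_c k * x z + co_d k * (h z)\<^sup>2 + co_f20 k * (x z)\<^sup>2 + co_f11 k * x z * h z))
     + co_c k * (x z - lam * (x' z + \<beta> * y0 * (x' z)\<^sup>2)) + co_d k * (h z * h z - L z * L z)
     + co_f20 k * (x z * x z - (lam * x' z) * (lam * x' z)) + co_f11 k * (x z * h z - (lam * x' z) * L z))
      \<in> o[G](\<lambda>z. (r' z)\<^sup>2)"
    by (intro sum_in_smallo cmult_smallo hh xx xh 1 5)
  ultimately show ?thesis unfolding jet_def pre_coeffs_def global_coeffs.simps L_def
    by (simp add: algebra_simps power2_eq_square)
qed

lemma s0_post:
  assumes "lam * gam = 1"
  shows "s0 (lam * x0) (post_coeffs lam gam \<beta> x0 k) = s0 x0 k"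
proof -
  have gam: "gam = inverse lam" "lam \<noteq> 0" using assms inverse_unique[of lam gam] by auto
  show ?thesis using gam(2) unfolding gam(1)
    by (simp add: s0_def post_coeffs_def Let_def field_simps power2_eq_square)
qed

text \<open>
  Here the cancellation needs \<open>c x\<^sup>+ = y\<^sup>-\<close>, where \<open>y\<^sup>- = gam * y0\<close> belongs to the old base point:
  the part of the difference linear in \<open>\<beta>\<close> is a multiple of \<open>c x\<^sup>+ - y\<^sup>-\<close>, and the quadratic
  parts cancel.
\<close>

lemma s0_pre:
  assumes lg: "lam * gam = 1" and t: "co_c k * xp = gam * y0"
  shows "s0 xp (pre_coeffs lam gam \<beta> y0 k) = s0 xp k"
proof -
  have nz: "gam \<noteq> 0" using lg by auto
  have y0: "y0 = lam * (co_c k * xp)" using lg t by (simp add: mult.assoc[symmetric])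
  have lam: "lam = inverse gam" using lg nz by (simp add: field_simps)
  show ?thesis unfolding y0 lam using nz
    by (simp add: s0_def pre_coeffs_def Let_def field_simps power2_eq_square)
qed


section \<open>The local map in a chart near the saddle\<close>

text \<open>
  The jet of \<open>g\<close> at \<open>M\<close> in the chart \<open>\<phi>\<close>, with the point of the surface instead of its
  coordinates as the variable.  Composing \<open>g\<close> with the local map is then a substitution in the
  \<open>o\<close>-terms, without inverse charts.
\<close>

definition point_jet :: "('a::topological_space \<Rightarrow> real^2) \<Rightarrow> ('a \<Rightarrow> 'a) \<Rightarrow> 'a \<Rightarrow> global_coeffs \<Rightarrow> bool" where
  "point_jet \<phi> g M k \<longleftrightarrow>
     jet (at M) (\<lambda>z. norm (\<phi> z - \<phi> M)) (\<lambda>z. \<phi> z $ 1) (\<lambda>z. \<phi> z $ 2 - \<phi> M $ 2)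
       (\<lambda>z. \<phi> (g z) $ 1 - \<phi> (g M) $ 1) (\<lambda>z. \<phi> (g z) $ 2) k"

locale chart_near_saddle =
  fixes T :: "'a::t2_space \<Rightarrow> 'a" and P :: 'a and U :: "'a set" and \<phi> :: "'a \<Rightarrow> real^2"
    and lam gam \<beta>1 \<beta>2 \<beta>2' C :: real
  assumes bij_T: "bij T" and cont_T: "continuous_on UNIV T"
    and chart: "is_chart (U, \<phi>)"
    and P: "P \<in> U" "\<phi> P = 0"
    and nf: "\<And>z. z \<in> U \<Longrightarrow> T z \<in> U \<Longrightarrow> normal_form_bounds lam gam \<beta>1 \<beta>2 \<beta>2' C
      (\<phi> z $ 1) (\<phi> z $ 2) (\<phi> (T z) $ 1) (\<phi> (T z) $ 2)"
    and lam_gam: "lam * gam = 1" and lam: "\<bar>lam\<bar> < 1"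
begin

lemma open_U: "open U" and open_image: "open (\<phi> ` U)"
  and cont_\<phi>: "continuous_on U \<phi>" and cont_inv: "continuous_on (\<phi> ` U) (inv_into U \<phi>)"
  and inv_\<phi>: "z \<in> U \<Longrightarrow> inv_into U \<phi> (\<phi> z) = z"
  using chart by (auto simp: is_chart_def homeomorphism_def)

lemma tendsto_\<phi>: "M \<in> U \<Longrightarrow> (g \<longlongrightarrow> M) G \<Longrightarrow> ((\<lambda>z. \<phi> (g z)) \<longlongrightarrow> \<phi> M) G"
  using cont_\<phi> open_U by (metis continuous_on_eq_continuous_at isCont_tendsto_compose)

lemma tendsto_T: "(g \<longlongrightarrow> M) G \<Longrightarrow> ((\<lambda>z. T (g z)) \<longlongrightarrow> T M) G"
  using cont_T by (metis UNIV_I continuous_on_eq_continuous_at isCont_tendsto_compose open_UNIV)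

lemma eventually_in_U: "M \<in> U \<Longrightarrow> (g \<longlongrightarrow> M) G \<Longrightarrow> \<forall>\<^sub>F z in G. g z \<in> U"
  using open_U by (rule topological_tendstoD[rotated])

lemma tendsto_radius: "M \<in> U \<Longrightarrow> ((\<lambda>z. norm (\<phi> z - \<phi> M)) \<longlongrightarrow> 0) (at M)"
  using tendsto_\<phi>[of M "\<lambda>z. z" "at M"] by (simp add: tendsto_norm_zero LIM_zero)

lemma coords_bigo:
  "(\<lambda>z. \<phi> z $ i - \<phi> M $ i) \<in> O[G](\<lambda>z. norm (\<phi> z - \<phi> M))"
proof (rule landau_o.bigI[of 1])
  show "\<forall>\<^sub>F z in G. norm (\<phi> z $ i - \<phi> M $ i) \<le> 1 * norm (norm (\<phi> z - \<phi> M))"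
    using component_le_norm_cart[of "\<phi> z - \<phi> M" i for z] by (auto intro!: always_eventually)
qed simp

lemma T_first_axis:
  assumes "z \<in> U" "T z \<in> U" "\<phi> z $ 2 = 0"
  shows "\<phi> (T z) $ 1 = lam * \<phi> z $ 1" "\<phi> (T z) $ 2 = 0"
  using nf[OF assms(1,2)] assms(3) by (auto simp: normal_form_bounds_def)

lemma T_second_axis:
  assumes "z \<in> U" "T z \<in> U" "\<phi> z $ 1 = 0"
  shows "\<phi> (T z) $ 1 = 0" "\<phi> (T z) $ 2 = gam * \<phi> z $ 2"
  using nf[OF assms(1,2)] assms(3) by (auto simp: normal_form_bounds_def)

lemma point_jet_post:
  assumes j: "point_jet \<phi> g M k" and M: "M \<in> U" "\<phi> M $ 1 = 0"
    and g: "isCont g M" and gM: "g M \<in> U" "T (g M) \<in> U" "\<phi> (g M) $ 2 = 0"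
  shows "point_jet \<phi> (T \<circ> g) M (post_coeffs lam gam \<beta>1 (\<phi> (g M) $ 1) k)"
proof -
  have glim: "(g \<longlongrightarrow> g M) (at M)" using g by (simp add: isCont_def)
  have nf': "\<forall>\<^sub>F z in at M. normal_form_bounds lam gam \<beta>1 \<beta>2 \<beta>2' C (\<phi> (g z) $ 1) (\<phi> (g z) $ 2)
      (\<phi> (T (g z)) $ 1) (\<phi> (T (g z)) $ 2)"
    using eventually_in_U[OF gM(1) glim] eventually_in_U[OF gM(2) tendsto_T[OF glim]]
    by eventually_elim (rule nf)
  have X: "((\<lambda>z. \<phi> (g z) $ 1) \<longlongrightarrow> \<phi> (g M) $ 1) (at M)"
    and Y: "((\<lambda>z. \<phi> (g z) $ 2) \<longlongrightarrow> 0) (at M)"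
    using tendsto_vec_nth[OF tendsto_\<phi>[OF gM(1) glim]] gM(3) by metis+
  note T_jet = normal_form_along_first_axis[OF nf' X Y]
  have x: "(\<lambda>z. \<phi> z $ 1) \<in> O[at M](\<lambda>z. norm (\<phi> z - \<phi> M))"
    using coords_bigo[of 1 M] M(2) by simp
  show ?thesis unfolding point_jet_def o_def
  proof (rule jet_post[OF j[unfolded point_jet_def] tendsto_radius[OF M(1)] x coords_bigo])
    show "(\<lambda>z. \<phi> (T (g z)) $ 1 - \<phi> (T (g M)) $ 1 -
        lam * (\<phi> (g z) $ 1 - \<phi> (g M) $ 1 + \<beta>1 * (\<phi> (g M) $ 1)\<^sup>2 * \<phi> (g z) $ 2))
        \<in> o[at M](\<lambda>z. \<phi> (g z) $ 2)"
      using T_jet(1) T_first_axis(1)[OF gM] by (simp add: algebra_simps)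
  qed (rule T_jet(2))
qed

text \<open>
  The normal form along the first axis is applied with the roles of the coordinates exchanged.
  The size of \<open>T z\<close> relative to \<open>T w\<close> is bounded by that of \<open>z\<close> relative to \<open>w\<close>, so the
  error terms of \<open>g\<close> keep their order.
\<close>

lemma point_jet_pre:
  assumes j: "point_jet \<phi> g (T w) k" and w: "w \<in> U" "T w \<in> U" "\<phi> w $ 1 = 0"
  shows "point_jet \<phi> (g \<circ> T) w (pre_coeffs lam gam \<beta>1 (\<phi> w $ 2) k)"
proof -
  define r where "r z = norm (\<phi> z - \<phi> w)" for z
  have T_lim: "(T \<longlongrightarrow> T w) (at w)" using tendsto_T[of "\<lambda>z. z"] by simp
  have "inj T" using bij_T by (rule bij_is_inj)
  hence T_at: "filterlim T (at (T w)) (at w)"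
    using T_lim by (auto simp: filterlim_at eventually_at_filter inj_eq)
  have nf': "\<forall>\<^sub>F z in at w. normal_form_bounds gam lam (-\<beta>1) \<beta>2' \<beta>2 C (\<phi> z $ 2) (\<phi> z $ 1)
      (\<phi> (T z) $ 2) (\<phi> (T z) $ 1)"
    using eventually_in_U[OF w(1) tendsto_ident_at] eventually_in_U[OF w(2) T_lim]
    by eventually_elim (use nf normal_form_bounds_swap in blast)
  have X: "((\<lambda>z. \<phi> z $ 2) \<longlongrightarrow> \<phi> w $ 2) (at w)"
    and Y: "((\<lambda>z. \<phi> z $ 1) \<longlongrightarrow> 0) (at w)"
    using tendsto_vec_nth[OF tendsto_\<phi>[OF w(1) tendsto_ident_at]] w(3) by metis+
  note T_jet = normal_form_along_first_axis[OF nf' X Y]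
  have r0: "(r \<longlongrightarrow> 0) (at w)" using tendsto_radius[OF w(1)] by (simp add: r_def[abs_def])
  have x': "(\<lambda>z. \<phi> z $ 1) \<in> O[at w](r)"
    using coords_bigo[of 1 w] w(3) by (simp add: r_def[abs_def])
  have h': "(\<lambda>z. \<phi> z $ 2 - \<phi> w $ 2) \<in> O[at w](r)"
    using coords_bigo[of 2 w] by (simp add: r_def[abs_def])
  have x: "(\<lambda>z. \<phi> (T z) $ 1 - lam * (\<phi> z $ 1 + \<beta>1 * \<phi> w $ 2 * (\<phi> z $ 1)\<^sup>2))
      \<in> o[at w](\<lambda>z. (\<phi> z $ 1)\<^sup>2)"
    using T_jet(2) by simp
  have h: "(\<lambda>z. \<phi> (T z) $ 2 - \<phi> (T w) $ 2 -
        gam * (\<phi> z $ 2 - \<phi> w $ 2 - \<beta>1 * (\<phi> w $ 2)\<^sup>2 * \<phi> z $ 1)) \<in> o[at w](\<lambda>z. \<phi> z $ 1)"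
    using T_jet(1) T_second_axis(2)[OF w] by (simp add: algebra_simps)
  have xx: "(\<lambda>z. (\<phi> z $ 1)\<^sup>2) \<in> O[at w](r)"
    using landau_o.big_trans[OF landau_o.small_imp_big[OF tendsto_0_mult_smallo[OF Y, of "\<lambda>z. \<phi> z $ 1"]] x']
    by (simp add: power2_eq_square)
  have "(\<lambda>z. (\<phi> (T z) $ 1 - lam * (\<phi> z $ 1 + \<beta>1 * \<phi> w $ 2 * (\<phi> z $ 1)\<^sup>2))
      + lam * \<phi> z $ 1 + lam * \<beta>1 * \<phi> w $ 2 * (\<phi> z $ 1)\<^sup>2) \<in> O[at w](r)"
    by (intro sum_in_bigo cmult_bigo x' xx landau_o.big_trans[OF landau_o.small_imp_big[OF x]])
  hence Tx: "(\<lambda>z. \<phi> (T z) $ 1) \<in> O[at w](r)" by (simp add: algebra_simps)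
  have "(\<lambda>z. (\<phi> (T z) $ 2 - \<phi> (T w) $ 2 -
        gam * (\<phi> z $ 2 - \<phi> w $ 2 - \<beta>1 * (\<phi> w $ 2)\<^sup>2 * \<phi> z $ 1))
        + gam * (\<phi> z $ 2 - \<phi> w $ 2) - gam * \<beta>1 * (\<phi> w $ 2)\<^sup>2 * \<phi> z $ 1) \<in> O[at w](r)"
    by (intro sum_in_bigo cmult_bigo x' h' landau_o.big_trans[OF landau_o.small_imp_big[OF h]])
  hence Th: "(\<lambda>z. \<phi> (T z) $ 2 - \<phi> (T w) $ 2) \<in> O[at w](r)" by (simp add: algebra_simps)
  have "(\<lambda>z. norm (\<phi> (T z) - \<phi> (T w))) \<in> O[at w](\<lambda>z. \<bar>\<phi> (T z) $ 1\<bar> + \<bar>\<phi> (T z) $ 2 - \<phi> (T w) $ 2\<bar>)"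
  proof (rule landau_o.bigI[of 1])
    show "\<forall>\<^sub>F z in at w. norm (norm (\<phi> (T z) - \<phi> (T w)))
       \<le> 1 * norm (\<bar>\<phi> (T z) $ 1\<bar> + \<bar>\<phi> (T z) $ 2 - \<phi> (T w) $ 2\<bar>)"
      using norm_le_l1_cart[of "\<phi> (T z) - \<phi> (T w)" for z] T_second_axis(1)[OF w]
      by (auto simp: sum_2 intro!: always_eventually)
  qed simp
  moreover have "(\<lambda>z. \<bar>\<phi> (T z) $ 1\<bar> + \<bar>\<phi> (T z) $ 2 - \<phi> (T w) $ 2\<bar>) \<in> O[at w](r)"
    using Tx Th by (intro sum_in_bigo) simp_all
  ultimately have rT: "(\<lambda>z. norm (\<phi> (T z) - \<phi> (T w))) \<in> O[at w](r)" by (rule landau_o.big_trans)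
  have "jet (at w) (\<lambda>z. norm (\<phi> (T z) - \<phi> (T w))) (\<lambda>z. \<phi> (T z) $ 1) (\<lambda>z. \<phi> (T z) $ 2 - \<phi> (T w) $ 2)
      (\<lambda>z. \<phi> (g (T z)) $ 1 - \<phi> (g (T w)) $ 1) (\<lambda>z. \<phi> (g (T z)) $ 2) k"
    using j unfolding point_jet_def jet_def
    by (auto dest: landau_o.small.compose[OF _ T_at])
  from jet_pre[OF this rT x' h' x h r0] show ?thesis
    unfolding point_jet_def o_def by (simp add: r_def[abs_def])
qed

text \<open>
  Local unstable points lie on the second axis even if the chart is large.  Along the backward
  orbit the first coordinates tend to zero, yet near the saddle they grow by a factor close to
  \<open>1 / \<bar>lam\<bar>\<close> at each backward step; so they vanish from some time on.  As the second axis is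
  mapped into itself, they vanish at all times.
\<close>

lemma local_unstable_first_coord:
  assumes "z \<in> local_unstable_set T U P"
  shows "\<phi> z $ 1 = 0"
proof -
  define w where "w n = (inv T ^^ n) z" for n
  have w: "w n \<in> U" "w \<longlonglongrightarrow> P" for n
    using assms by (auto simp: local_unstable_set_def local_stable_set_def stable_set_def w_def[abs_def])
  have Tw: "T (w (Suc n)) = w n" for n
    using bij_T by (simp add: w_def bij_is_surj surj_f_inv_f)
  define x y where "x n = \<phi> (w n) $ 1" and "y n = \<phi> (w n) $ 2" for n
  have lim: "x \<longlonglongrightarrow> 0" "y \<longlonglongrightarrow> 0"
    using tendsto_vec_nth[OF tendsto_\<phi>[OF P(1) w(2)]] P(2)
    by (auto simp: x_def[abs_def] y_def[abs_def] dest: spec)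
  note lim' = LIMSEQ_Suc[OF lim(1)] LIMSEQ_Suc[OF lim(2)]
  define m where "m n = \<bar>lam * (1 + \<beta>1 * (x (Suc n) * y (Suc n)) + \<beta>2 * (x (Suc n) * y (Suc n))\<^sup>2)\<bar>
      + C * (\<bar>x (Suc n)\<bar>^2 * \<bar>y (Suc n)\<bar>^2 * (\<bar>x (Suc n)\<bar> + \<bar>y (Suc n)\<bar>))" for n
  have bound: "\<bar>x n\<bar> \<le> m n * \<bar>x (Suc n)\<bar>" for n
  proof -
    let ?c = "lam * (1 + \<beta>1 * (x (Suc n) * y (Suc n)) + \<beta>2 * (x (Suc n) * y (Suc n))\<^sup>2)"
    let ?e = "C * (\<bar>x (Suc n)\<bar>^2 * \<bar>y (Suc n)\<bar>^2 * (\<bar>x (Suc n)\<bar> + \<bar>y (Suc n)\<bar>))"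
    have "\<bar>x n - ?c * x (Suc n)\<bar>
        \<le> C * (\<bar>x (Suc n)\<bar> ^ 3 * \<bar>y (Suc n)\<bar> ^ 2 * (\<bar>x (Suc n)\<bar> + \<bar>y (Suc n)\<bar>))"
      using nf[OF w(1)[of "Suc n"]] w(1)[of n] by (simp add: Tw normal_form_bounds_def x_def y_def mult_ac)
    also have "\<dots> = ?e * \<bar>x (Suc n)\<bar>" by (simp only: power3_eq_cube power2_eq_square mult_ac)
    finally have "\<bar>x n - ?c * x (Suc n)\<bar> \<le> ?e * \<bar>x (Suc n)\<bar>" .
    hence "\<bar>x n\<bar> \<le> \<bar>?c * x (Suc n)\<bar> + ?e * \<bar>x (Suc n)\<bar>" by linarith
    also have "\<dots> = m n * \<bar>x (Suc n)\<bar>" unfolding m_def abs_mult distrib_right ..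
    finally show ?thesis .
  qed
  have "m \<longlonglongrightarrow> \<bar>lam * (1 + \<beta>1 * (0 * 0) + \<beta>2 * (0 * 0)\<^sup>2)\<bar> + C * (\<bar>0\<bar>^2 * \<bar>0\<bar>^2 * (\<bar>0\<bar> + \<bar>0\<bar>))"
    unfolding m_def by (intro tendsto_intros lim')
  hence "m \<longlonglongrightarrow> \<bar>lam\<bar>" by simp
  hence "\<forall>\<^sub>F n in sequentially. m n < 1" using lam by (rule order_tendstoD)
  then obtain N where N: "\<And>n. n \<ge> N \<Longrightarrow> m n < 1" by (auto simp: eventually_sequentially)
  have step: "\<bar>x n\<bar> \<le> \<bar>x (Suc n)\<bar>" if "n \<ge> N" for n
    using bound[of n] mult_right_mono[of "m n" 1 "\<bar>x (Suc n)\<bar>"] N[OF that] by simp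
  have "incseq (\<lambda>n. \<bar>x (n + N)\<bar>)" by (rule incseq_SucI) (simp add: step)
  moreover have "(\<lambda>n. \<bar>x (n + N)\<bar>) \<longlonglongrightarrow> 0"
    using LIMSEQ_ignore_initial_segment[OF tendsto_rabs_zero[OF lim(1)]] .
  ultimately have "\<bar>x (0 + N)\<bar> \<le> 0" by (rule incseq_le)
  hence "x N = 0" by simp
  moreover have "x n = 0" if "x (Suc n) = 0" for n using bound[of n] that by simp
  ultimately have "x 0 = 0" by (induction N) auto
  thus ?thesis by (simp add: x_def w_def)
qed

lemma local_unstable_backward:
  assumes "M \<in> local_unstable_set T U P"
  shows "(inv T ^^ n) M \<in> local_unstable_set T U P"
proof -
  have add: "(inv T ^^ i) ((inv T ^^ n) M) = (inv T ^^ (i + n)) M" for i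
    by (simp add: funpow_add)
  have "(\<lambda>i. (inv T ^^ (i + n)) M) \<longlonglongrightarrow> P"
    using assms by (intro LIMSEQ_ignore_initial_segment)
      (simp add: local_unstable_set_def local_stable_set_def stable_set_def)
  thus ?thesis using assms
    by (simp add: local_unstable_set_def local_stable_set_def stable_set_def add)
qed

lemma isCont_funpow_T: "isCont (T ^^ n) M"
proof (induction n)
  case (Suc n)
  thus ?case using tendsto_T[of "T ^^ n" "(T ^^ n) M" "at M"] by (simp add: isCont_def o_def)
qed (simp add: id_def)

lemma point_jet_post_iterate:
  assumes j: "point_jet \<phi> g M k" and M: "M \<in> U" "\<phi> M $ 1 = 0" and g: "isCont g M"
    and gM: "\<And>n. (T ^^ n) (g M) \<in> U" "\<phi> (g M) $ 2 = 0"
  shows "\<exists>k'. point_jet \<phi> ((T ^^ n) \<circ> g) M k' \<and>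
     \<phi> ((T ^^ n) (g M)) $ 1 = lam ^ n * \<phi> (g M) $ 1 \<and> \<phi> ((T ^^ n) (g M)) $ 2 = 0 \<and>
     s0 (\<phi> ((T ^^ n) (g M)) $ 1) k' = s0 (\<phi> (g M) $ 1) k \<and>
     co_c k' * \<phi> ((T ^^ n) (g M)) $ 1 = co_c k * \<phi> (g M) $ 1"
proof (induction n)
  case 0
  show ?case using j gM(2) by auto
next
  case (Suc n)
  then obtain k' where k': "point_jet \<phi> ((T ^^ n) \<circ> g) M k'"
     "\<phi> ((T ^^ n) (g M)) $ 1 = lam ^ n * \<phi> (g M) $ 1" "\<phi> ((T ^^ n) (g M)) $ 2 = 0"
     "s0 (\<phi> ((T ^^ n) (g M)) $ 1) k' = s0 (\<phi> (g M) $ 1) k"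
     "co_c k' * \<phi> ((T ^^ n) (g M)) $ 1 = co_c k * \<phi> (g M) $ 1" by blast
  let ?Q = "(T ^^ n) (g M)"
  have Q: "?Q \<in> U" "T ?Q \<in> U" using gM(1)[of n] gM(1)[of "Suc n"] by simp_all
  have cont: "isCont ((T ^^ n) \<circ> g) M" unfolding o_def using g isCont_funpow_T by (rule isCont_o2)
  note T = T_first_axis[OF Q k'(3)]
  have c: "gam * c * (lam * u) = c * u" for c u
  proof -
    have "gam * c * (lam * u) = (lam * gam) * (c * u)" by (simp only: mult_ac)
    thus ?thesis by (simp add: lam_gam)
  qed
  show ?case
    using point_jet_post[OF k'(1) M cont] Q k' T s0_post[OF lam_gam, of "\<phi> ?Q $ 1" \<beta>1 k']
    by (intro exI[of _ "post_coeffs lam gam \<beta>1 (\<phi> ?Q $ 1) k'"])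
       (simp add: o_def post_coeffs_def c)
qed

text \<open>
  The equation \<open>c x\<^sup>+ = y\<^sup>-\<close> is passed on as an equivalence: it is known for one pair, and reaches
  any other pair through the common one by going forward and back.
\<close>

lemma point_jet_pre_iterate:
  assumes j: "point_jet \<phi> g M k" and M: "M \<in> local_unstable_set T U P"
  shows "\<exists>k'. point_jet \<phi> (g \<circ> (T ^^ n)) ((inv T ^^ n) M) k' \<and>
     (co_c k' * xp = \<phi> ((inv T ^^ n) M) $ 2 \<longleftrightarrow> co_c k * xp = \<phi> M $ 2) \<and>
     (co_c k * xp = \<phi> M $ 2 \<longrightarrow> s0 xp k' = s0 xp k)"
proof (induction n)
  case 0
  show ?case using j by auto
next
  case (Suc n)
  then obtain k' where k': "point_jet \<phi> (g \<circ> (T ^^ n)) ((inv T ^^ n) M) k'"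
     "co_c k' * xp = \<phi> ((inv T ^^ n) M) $ 2 \<longleftrightarrow> co_c k * xp = \<phi> M $ 2"
     "co_c k * xp = \<phi> M $ 2 \<longrightarrow> s0 xp k' = s0 xp k" by blast
  define w where "w = (inv T ^^ Suc n) M"
  have Tw: "T w = (inv T ^^ n) M" using bij_T by (simp add: w_def bij_is_surj surj_f_inv_f)
  have inU: "(inv T ^^ n) M \<in> U" for n
    using M by (simp add: local_unstable_set_def local_stable_set_def)
  have w: "w \<in> U" "T w \<in> U" "\<phi> w $ 1 = 0"
    using inU[of "Suc n"] inU[of n] local_unstable_first_coord[OF local_unstable_backward[OF M, of "Suc n"]] Tw
    by (simp_all add: w_def)
  note T2 = T_second_axis(2)[OF w]
  have iff: "co_c (pre_coeffs lam gam \<beta>1 (\<phi> w $ 2) k') * xp = \<phi> w $ 2 \<longleftrightarrow> co_c k' * xp = \<phi> (T w) $ 2"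
  proof -
    have "lam * \<phi> (T w) $ 2 = (lam * gam) * \<phi> w $ 2" using T2 by (simp only: mult.assoc)
    hence "\<phi> w $ 2 = lam * \<phi> (T w) $ 2" by (simp add: lam_gam)
    moreover have "lam \<noteq> 0" using lam_gam by auto
    ultimately show ?thesis by (simp add: pre_coeffs_def)
  qed
  have "point_jet \<phi> (g \<circ> (T ^^ n) \<circ> T) w (pre_coeffs lam gam \<beta>1 (\<phi> w $ 2) k')"
    using k'(1) by (intro point_jet_pre w) (simp add: Tw)
  hence "point_jet \<phi> (g \<circ> (T ^^ Suc n)) w (pre_coeffs lam gam \<beta>1 (\<phi> w $ 2) k')"
    by (simp only: o_assoc[symmetric] funpow_Suc_right)
  moreover have "co_c (pre_coeffs lam gam \<beta>1 (\<phi> w $ 2) k') * xp = \<phi> w $ 2 \<longleftrightarrow> co_c k * xp = \<phi> M $ 2"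
    using iff k'(2) Tw by simp
  moreover have "s0 xp (pre_coeffs lam gam \<beta>1 (\<phi> w $ 2) k') = s0 xp k" if "co_c k * xp = \<phi> M $ 2"
    using s0_pre[OF lam_gam, of k' xp "\<phi> w $ 2" \<beta>1] k' that T2 Tw by simp
  ultimately show ?case unfolding w_def[symmetric] by blast
qed

text \<open>
  Along a line through the base point in direction \<open>v\<close> the difference of the two expansions is a
  polynomial in one variable that is too small to be nonzero; three directions separate
  all six coefficients.
\<close>

lemma point_jet_unique:
  assumes M: "M \<in> U" "\<phi> M $ 1 = 0" and k: "point_jet \<phi> g M k" and l: "point_jet \<phi> g M l"
  shows "k = l"
proof -
  define A B c d e f where "A = co_a k - co_a l" "B = co_b k - co_b l" "c = co_c k - co_c l"
    "d = co_d k - co_d l" "e = co_f20 k - co_f20 l" "f = co_f11 k - co_f11 l"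
  note defs = this
  have 1: "(\<lambda>z. A * \<phi> z $ 1 + B * (\<phi> z $ 2 - \<phi> M $ 2)) \<in> o[at M](\<lambda>z. norm (\<phi> z - \<phi> M))"
    using sum_in_smallo(2)[OF l[unfolded point_jet_def jet_def, THEN conjunct1]
        k[unfolded point_jet_def jet_def, THEN conjunct1]]
    by (simp add: defs algebra_simps)
  have 2: "(\<lambda>z. c * \<phi> z $ 1 + d * (\<phi> z $ 2 - \<phi> M $ 2)\<^sup>2 + e * (\<phi> z $ 1)\<^sup>2 + f * \<phi> z $ 1 * (\<phi> z $ 2 - \<phi> M $ 2))
     \<in> o[at M](\<lambda>z. (norm (\<phi> z - \<phi> M))\<^sup>2)"
    using sum_in_smallo(2)[OF l[unfolded point_jet_def jet_def, THEN conjunct2]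
        k[unfolded point_jet_def jet_def, THEN conjunct2]]
    by (simp add: defs algebra_simps)
  have line: "A * v $ 1 + B * v $ 2 = 0 \<and> c * v $ 1 = 0 \<and>
      d * (v $ 2)\<^sup>2 + e * (v $ 1)\<^sup>2 + f * v $ 1 * v $ 2 = 0" if v: "v \<noteq> 0" for v :: "real^2"
  proof -
    define p where "p t = inv_into U \<phi> (\<phi> M + t *\<^sub>R v)" for t
    have "((\<lambda>t. \<phi> M + t *\<^sub>R v) \<longlongrightarrow> \<phi> M + 0 *\<^sub>R v) (at 0)" by (intro tendsto_intros)
    hence lin: "((\<lambda>t. \<phi> M + t *\<^sub>R v) \<longlongrightarrow> \<phi> M) (at 0)" by simp
    have "isCont (inv_into U \<phi>) (\<phi> M)"
      using cont_inv open_image M by (simp add: continuous_on_eq_continuous_at)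
    from isCont_tendsto_compose[OF this lin] have pM: "(p \<longlongrightarrow> M) (at 0)"
      by (simp add: p_def[abs_def] inv_\<phi> M)
    have "\<forall>\<^sub>F t in at 0. \<phi> M + t *\<^sub>R v \<in> \<phi> ` U"
      using topological_tendstoD[OF lin open_image] M by simp
    hence \<phi>p: "\<forall>\<^sub>F t in at 0. \<phi> (p t) = \<phi> M + t *\<^sub>R v"
      by eventually_elim (simp add: p_def f_inv_into_f)
    moreover have "\<forall>\<^sub>F t in at (0::real). t \<noteq> 0" by (simp add: eventually_at_filter)
    ultimately have "\<forall>\<^sub>F t in at 0. p t \<noteq> M" by eventually_elim (use v in auto)
    with pM have p_at: "filterlim p (at M) (at 0)" by (simp add: filterlim_at)
    have scale: "(\<lambda>t::real. norm (t *\<^sub>R v)) \<in> O[at 0](\<lambda>t. t)"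
      by (rule landau_o.bigI[of "norm v"]) (use v in \<open>auto simp: mult.commute\<close>)
    have "(\<lambda>t. A * \<phi> (p t) $ 1 + B * (\<phi> (p t) $ 2 - \<phi> M $ 2)) \<in> o[at 0](\<lambda>t. norm (\<phi> (p t) - \<phi> M))"
      using landau_o.small.compose[OF 1 p_at] .
    also have "?this \<longleftrightarrow> (\<lambda>t. (A * v $ 1 + B * v $ 2) * t) \<in> o[at 0](\<lambda>t. norm (t *\<^sub>R v))"
      by (rule landau_o.small.cong_ex; use \<phi>p in eventually_elim) (simp_all add: M algebra_simps)
    finally have L: "(\<lambda>t. (A * v $ 1 + B * v $ 2) * t) \<in> o[at 0](\<lambda>t. t)"
      using scale by (rule landau_o.small_big_trans)
    have "(\<lambda>t. c * \<phi> (p t) $ 1 + d * (\<phi> (p t) $ 2 - \<phi> M $ 2)\<^sup>2 + e * (\<phi> (p t) $ 1)\<^sup>2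
        + f * \<phi> (p t) $ 1 * (\<phi> (p t) $ 2 - \<phi> M $ 2)) \<in> o[at 0](\<lambda>t. (norm (\<phi> (p t) - \<phi> M))\<^sup>2)"
      using landau_o.small.compose[OF 2 p_at] .
    also have "?this \<longleftrightarrow> (\<lambda>t. (c * v $ 1) * t + (d * (v $ 2)\<^sup>2 + e * (v $ 1)\<^sup>2 + f * v $ 1 * v $ 2) * t\<^sup>2)
        \<in> o[at 0](\<lambda>t. (norm (t *\<^sub>R v))\<^sup>2)"
      by (rule landau_o.small.cong_ex; use \<phi>p in eventually_elim)
         (simp_all add: M algebra_simps power2_eq_square)
    finally have Q: "(\<lambda>t. (c * v $ 1) * t + (d * (v $ 2)\<^sup>2 + e * (v $ 1)\<^sup>2 + f * v $ 1 * v $ 2) * t\<^sup>2)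
        \<in> o[at 0](\<lambda>t. t\<^sup>2)"
      using landau_o.big_power[OF scale] by (rule landau_o.small_big_trans)
    show ?thesis
      using linear_smallo_imp_zero[OF L] quadratic_smallo_imp_zero[OF Q] by simp
  qed
  have "vector [1, 0] \<noteq> (0 :: real^2)" "vector [0, 1] \<noteq> (0 :: real^2)" "vector [1, 1] \<noteq> (0 :: real^2)"
    by (simp_all add: vec_eq_iff forall_2)
  from this[THEN line] have "A = 0" "B = 0" "c = 0" "d = 0" "e = 0" "f = 0" by auto
  thus ?thesis by (simp add: defs)
qed

end


section \<open>From pairs of homoclinic points to jets\<close>

text \<open>
  The coefficients in the coordinates \<open>(\<sigma> x, \<rho> y)\<close>, for signs \<open>\<sigma>\<close> and \<open>\<rho>\<close>.
\<close>

definition flip_coeffs :: "real \<Rightarrow> real \<Rightarrow> global_coeffs \<Rightarrow> global_coeffs" where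
  "flip_coeffs \<sigma> \<rho> k =
     \<lparr>co_a = co_a k, co_b = \<sigma> * \<rho> * co_b k, co_c = \<sigma> * \<rho> * co_c k, co_d = \<rho> * co_d k,
      co_f20 = \<rho> * co_f20 k, co_f11 = \<sigma> * co_f11 k\<rparr>"

lemma s0_flip:
  assumes "\<sigma> \<in> {-1, 1}" "\<rho> \<in> {-1, 1}"
  shows "s0 (\<sigma> * xp) (flip_coeffs \<sigma> \<rho> k) = s0 xp k"
  using assms by (auto simp: s0_def flip_coeffs_def Let_def algebra_simps)

lemma jet_flip:
  assumes "\<sigma> \<in> {-1, 1}" "\<rho> \<in> {-1, 1}" and "jet G r x h X Y k"
  shows "jet G r (\<lambda>z. \<sigma> * x z) (\<lambda>z. \<rho> * h z) (\<lambda>z. \<sigma> * X z) (\<lambda>z. \<rho> * Y z) (flip_coeffs \<sigma> \<rho> k)"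
proof -
  have sq: "\<sigma>\<^sup>2 = 1" "\<rho>\<^sup>2 = 1" and cancel: "\<sigma> * (\<sigma> * u) = u" "\<rho> * (\<rho> * u) = u" for u
    using assms(1,2) by auto
  show ?thesis
    using assms(3) cmult_smallo[of _ G r \<sigma>] cmult_smallo[of _ G "\<lambda>z. (r z)\<^sup>2" \<rho>]
    unfolding jet_def flip_coeffs_def global_coeffs.simps power_mult_distrib sq
    by (fastforce simp: algebra_simps cancel)
qed

text \<open>
  Substituting the chart for the variable \<open>(x, h)\<close> turns the Taylor expansion in coordinates into
  one at the point \<open>M\<close>; the chart is injective, so \<open>z \<noteq> M\<close> becomes \<open>(x, h) \<noteq> (0, 0)\<close>.
\<close>

lemma global_expansion_imp_jet:
  fixes \<phi> :: "'a::t2_space \<Rightarrow> real^2"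
  assumes exp: "global_map_expansion (in_charts g (U, \<phi>) (U, \<phi>)) xp ym k"
    and U: "open U" "inj_on \<phi> U" "continuous_on U \<phi>"
    and M: "M \<in> U" "\<phi> M = vector [0, ym]" and gM: "\<phi> (g M) = vector [xp, 0]"
  shows "point_jet \<phi> g M k"
proof -
  define v where "v z = (\<phi> z $ 1, \<phi> z $ 2 - ym)" for z
  have inU: "\<forall>\<^sub>F z in at M. z \<in> U" using U(1) M(1) by (rule eventually_at_in_open')
  have "(\<phi> \<longlongrightarrow> \<phi> M) (at M)"
    using U(1,3) M(1) by (simp add: continuous_on_eq_continuous_at isCont_def)
  hence c: "((\<lambda>z. \<phi> z $ i) \<longlongrightarrow> \<phi> M $ i) (at M)" for i by (rule tendsto_vec_nth)
  have x0: "((\<lambda>z. \<phi> z $ 1) \<longlongrightarrow> 0) (at M)" and h0: "((\<lambda>z. \<phi> z $ 2 - ym) \<longlongrightarrow> 0) (at M)"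
    using c[of 1] tendsto_diff[OF c[of 2] tendsto_const[of ym]] M(2) by simp_all
  have "(v \<longlongrightarrow> (0, 0)) (at M)" unfolding v_def by (intro tendsto_Pair x0 h0)
  moreover have "\<forall>\<^sub>F z in at M. z \<noteq> M" by (simp add: eventually_at_filter)
  with inU have "\<forall>\<^sub>F z in at M. v z \<noteq> (0, 0)"
  proof eventually_elim
    case (elim z)
    hence "\<phi> z \<noteq> \<phi> M" using U(2) M(1) by (auto dest: inj_onD)
    thus ?case using M(2) by (auto simp: v_def vec_eq_iff forall_2)
  qed
  ultimately have v: "filterlim v (at (0, 0)) (at M)" by (simp add: filterlim_at)
  have r2: "(norm (\<phi> z - \<phi> M))\<^sup>2 = (\<phi> z $ 1)\<^sup>2 + (\<phi> z $ 2 - ym)\<^sup>2" for z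
    by (simp add: norm_vec_def L2_set_def sum_2 M(2) real_sqrt_pow2)
  have F: "\<forall>\<^sub>F z in at M. in_charts g (U, \<phi>) (U, \<phi>) (vector [\<phi> z $ 1, ym + (\<phi> z $ 2 - ym)]) = \<phi> (g z)"
    using inU
  proof eventually_elim
    case (elim z)
    have "vector [\<phi> z $ 1, ym + (\<phi> z $ 2 - ym)] = \<phi> z" by (simp add: vec_eq_iff forall_2)
    thus ?case using elim U(2) by (simp add: in_charts_def)
  qed
  obtain e20 e11 e02 where
    1: "(\<lambda>(x, h). in_charts g (U, \<phi>) (U, \<phi>) (vector [x, ym + h]) $ 1 - xp
          - (co_a k * x + co_b k * h + e20 * x\<^sup>2 + e11 * x * h + e02 * h\<^sup>2))
       \<in> o[at (0, 0)](\<lambda>(x, h). x\<^sup>2 + h\<^sup>2)" and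
    2: "(\<lambda>(x, h). in_charts g (U, \<phi>) (U, \<phi>) (vector [x, ym + h]) $ 2
          - (co_c k * x + co_d k * h\<^sup>2 + co_f20 k * x\<^sup>2 + co_f11 k * x * h))
       \<in> o[at (0, 0)](\<lambda>(x, h). x\<^sup>2 + h\<^sup>2)"
    using exp by (auto simp: global_map_expansion_def)
  let ?r = "\<lambda>z. norm (\<phi> z - \<phi> M)" and ?x = "\<lambda>z. \<phi> z $ 1" and ?h = "\<lambda>z. \<phi> z $ 2 - ym"
  have "(\<lambda>z. in_charts g (U, \<phi>) (U, \<phi>) (vector [?x z, ym + ?h z]) $ 1 - xp
          - (co_a k * ?x z + co_b k * ?h z + e20 * (?x z)\<^sup>2 + e11 * ?x z * ?h z + e02 * (?h z)\<^sup>2))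
       \<in> o[at M](\<lambda>z. (?r z)\<^sup>2)"
    using landau_o.small.compose[OF 1 v] by (simp only: v_def prod.case r2)
  also have "?this \<longleftrightarrow> (\<lambda>z. \<phi> (g z) $ 1 - xp
          - (co_a k * ?x z + co_b k * ?h z + e20 * (?x z)\<^sup>2 + e11 * ?x z * ?h z + e02 * (?h z)\<^sup>2))
       \<in> o[at M](\<lambda>z. (?r z)\<^sup>2)"
    by (rule landau_o.small.in_cong, use F in eventually_elim) simp
  finally have X: "(\<lambda>z. \<phi> (g z) $ 1 - xp
          - (co_a k * ?x z + co_b k * ?h z + e20 * (?x z)\<^sup>2 + e11 * ?x z * ?h z + e02 * (?h z)\<^sup>2))
       \<in> o[at M](\<lambda>z. (?r z)\<^sup>2)" .
  have "(\<lambda>z. in_charts g (U, \<phi>) (U, \<phi>) (vector [?x z, ym + ?h z]) $ 2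
          - (co_c k * ?x z + co_d k * (?h z)\<^sup>2 + co_f20 k * (?x z)\<^sup>2 + co_f11 k * ?x z * ?h z))
       \<in> o[at M](\<lambda>z. (?r z)\<^sup>2)"
    using landau_o.small.compose[OF 2 v] by (simp only: v_def prod.case r2)
  also have "?this \<longleftrightarrow> (\<lambda>z. \<phi> (g z) $ 2
          - (co_c k * ?x z + co_d k * (?h z)\<^sup>2 + co_f20 k * (?x z)\<^sup>2 + co_f11 k * ?x z * ?h z))
       \<in> o[at M](\<lambda>z. (?r z)\<^sup>2)"
    by (rule landau_o.small.in_cong, use F in eventually_elim) simp
  finally have Y: "(\<lambda>z. \<phi> (g z) $ 2
          - (co_c k * ?x z + co_d k * (?h z)\<^sup>2 + co_f20 k * (?x z)\<^sup>2 + co_f11 k * ?x z * ?h z))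
       \<in> o[at M](\<lambda>z. (?r z)\<^sup>2)" .
  have "(?r \<longlongrightarrow> 0) (at M)"
    using \<open>(\<phi> \<longlongrightarrow> \<phi> M) (at M)\<close> by (simp add: tendsto_norm_zero LIM_zero)
  note r0 = this and rr = square_smallo_radius[OF this]
  have x: "?x \<in> O[at M](?r)" and h: "?h \<in> O[at M](?r)"
  proof -
    have "\<bar>?x z\<bar> \<le> ?r z" "\<bar>?h z\<bar> \<le> ?r z" for z
      using component_le_norm_cart[of "\<phi> z - \<phi> M" 1] component_le_norm_cart[of "\<phi> z - \<phi> M" 2] M(2)
      by simp_all
    thus "?x \<in> O[at M](?r)" "?h \<in> O[at M](?r)"
      by (auto intro!: landau_o.bigI[of 1] always_eventually)
  qed
  have q: "(\<lambda>z. e * (u z * w z)) \<in> o[at M](?r)" if "u \<in> O[at M](?r)" "w \<in> O[at M](?r)" for e u w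
    by (intro cmult_smallo product_smallo_radius r0 that)
  have "(\<lambda>z. (\<phi> (g z) $ 1 - xp
          - (co_a k * ?x z + co_b k * ?h z + e20 * (?x z)\<^sup>2 + e11 * ?x z * ?h z + e02 * (?h z)\<^sup>2))
        + e20 * (?x z * ?x z) + e11 * (?x z * ?h z) + e02 * (?h z * ?h z)) \<in> o[at M](?r)"
    by (intro sum_in_smallo q x h landau_o.small_trans[OF X rr])
  hence X': "(\<lambda>z. \<phi> (g z) $ 1 - xp - (co_a k * ?x z + co_b k * ?h z)) \<in> o[at M](?r)"
    by (simp add: power2_eq_square algebra_simps)
  show ?thesis unfolding point_jet_def jet_def using X' Y gM M(2) by simp
qed

lemma point_jet_flip:
  assumes "\<sigma> \<in> {-1, 1}" "\<rho> \<in> {-1, 1}"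
    and "\<And>z. \<phi>' z = vector [\<sigma> * \<phi> z $ 1, \<rho> * \<phi> z $ 2]" and "point_jet \<phi>' g M k"
  shows "point_jet \<phi> g M (flip_coeffs \<sigma> \<rho> k)"
proof -
  have c: "\<phi> z $ 1 = \<sigma> * \<phi>' z $ 1" "\<phi> z $ 2 = \<rho> * \<phi>' z $ 2" for z
    using assms(1-3) by auto
  have sq: "\<sigma>\<^sup>2 = 1" "\<rho>\<^sup>2 = 1" using assms(1,2) by auto
  have "norm (\<phi> z - \<phi> M) = norm (\<phi>' z - \<phi>' M)" for z
    by (simp add: norm_vec_def L2_set_def sum_2 c right_diff_distrib[symmetric] power_mult_distrib sq)
  thus ?thesis
    using jet_flip[OF assms(1,2) assms(4)[unfolded point_jet_def]]
    unfolding point_jet_def by (simp add: c right_diff_distrib[symmetric])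
qed

text \<open>
  Undoing the sign changes that make \<open>xp\<close> and \<open>ym\<close> positive puts all pairs into one and the same
  chart.
\<close>

lemma pair_data_imp_point_jet:
  fixes \<phi> :: "'a::t2_space \<Rightarrow> real^2"
  assumes pd: "pair_data f p P \<Gamma> U \<phi> Mp Mm xp ym k" and chart: "is_chart (U, \<phi>)"
  obtains q k' where "(f ^^ q) Mm = Mp"
    "Mp \<in> \<Gamma> \<inter> local_stable_set (f ^^ p) U P" "Mm \<in> \<Gamma> \<inter> local_unstable_set (f ^^ p) U P"
    "\<phi> Mp $ 1 \<noteq> 0" "\<phi> Mp $ 2 = 0" "\<phi> Mm $ 1 = 0" "point_jet \<phi> (f ^^ q) Mm k'"
    "s0 (\<phi> Mp $ 1) k' = s0 xp k"
    "co_c k' * \<phi> Mp $ 1 = \<phi> Mm $ 2 \<longleftrightarrow> co_c k * xp = ym"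
proof -
  obtain \<phi>' q \<sigma> \<rho> where s: "\<sigma> \<in> {-1, 1}" "\<rho> \<in> {-1, 1}"
      "\<And>z. \<phi>' z = vector [\<sigma> * \<phi> z $ 1, \<rho> * \<phi> z $ 2]"
    and hp: "homoclinic_pair f p P \<Gamma> U \<phi>' Mp Mm q xp ym"
    and gm: "global_map_expansion (in_charts (f ^^ q) (U, \<phi>') (U, \<phi>')) xp ym k"
    using pd unfolding pair_data_def sign_change_def by blast
  have c: "\<phi> z $ 1 = \<sigma> * \<phi>' z $ 1" "\<phi> z $ 2 = \<rho> * \<phi>' z $ 2" for z
    using s by auto
  have U: "open U" "inj_on \<phi> U" "continuous_on U \<phi>"
    using chart by (auto simp: is_chart_def homeomorphism_def intro: inj_on_inverseI)
  have inj: "inj_on \<phi>' U"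
  proof (rule inj_onI)
    fix z w assume "z \<in> U" "w \<in> U" "\<phi>' z = \<phi>' w"
    hence "\<phi> z = \<phi> w" by (simp add: vec_eq_iff forall_2 c)
    thus "z = w" using U(2) \<open>z \<in> U\<close> \<open>w \<in> U\<close> by (auto dest: inj_onD)
  qed
  have "continuous_on U (\<lambda>z. \<chi> (i::2). if i = 1 then \<sigma> * \<phi> z $ 1 else \<rho> * \<phi> z $ 2)"
  proof (rule continuous_on_vec_lambda)
    fix i :: 2
    show "continuous_on U (\<lambda>z. if i = 1 then \<sigma> * \<phi> z $ 1 else \<rho> * \<phi> z $ 2)"
      by (cases "i = 1") (auto intro!: continuous_intros U(3))
  qed
  moreover have "\<phi>' = (\<lambda>z. \<chi> (i::2). if i = 1 then \<sigma> * \<phi> z $ 1 else \<rho> * \<phi> z $ 2)"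
    by (rule ext) (simp add: s(3) vec_eq_iff forall_2)
  ultimately have cont: "continuous_on U \<phi>'" by simp
  have hp': "(f ^^ q) Mm = Mp" "\<phi>' Mp = vector [xp, 0]" "\<phi>' Mm = vector [0, ym]" "xp > 0"
     "Mp \<in> \<Gamma> \<inter> local_stable_set (f ^^ p) U P" "Mm \<in> \<Gamma> \<inter> local_unstable_set (f ^^ p) U P"
    using hp by (auto simp: homoclinic_pair_def)
  have "Mm \<in> U" using hp'(6) by (force simp: local_unstable_set_def local_stable_set_def dest: spec[of _ 0])
  have "point_jet \<phi>' (f ^^ q) Mm k"
    by (rule global_expansion_imp_jet[OF gm U(1) inj cont \<open>Mm \<in> U\<close>]) (simp_all add: hp')
  from point_jet_flip[OF s this] have "point_jet \<phi> (f ^^ q) Mm (flip_coeffs \<sigma> \<rho> k)" .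
  moreover have "\<phi> Mp $ 1 = \<sigma> * xp" "\<phi> Mp $ 2 = 0" "\<phi> Mm $ 1 = 0" "\<phi> Mm $ 2 = \<rho> * ym"
    by (simp_all add: c hp')
  moreover have "co_c (flip_coeffs \<sigma> \<rho> k) * (\<sigma> * xp) = \<rho> * ym \<longleftrightarrow> co_c k * xp = ym"
    using s(1,2) by (auto simp: flip_coeffs_def)
  ultimately show thesis
    using that[OF hp'(1,5,6), of "flip_coeffs \<sigma> \<rho> k"] s(1,2) hp'(4) s0_flip[OF s(1,2), of xp k] by auto
qed

section \<open>The order of points on the homoclinic orbit\<close>

lemma full_orbit_linear:
  assumes bij: "bij f" and u: "u \<in> full_orbit f M" and v: "v \<in> full_orbit f M"
  obtains n where "v = (f ^^ n) u \<or> u = (f ^^ n) v"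
proof -
  have rewind: "(f ^^ n) ((inv f ^^ n) M) = M" for n
    using bij fn_o_inv_fn_is_id[of f n] by (metis comp_apply)
  have ahead: "\<exists>i j. (f ^^ i) w = (f ^^ j) M" if w: "w \<in> full_orbit f M" for w
  proof -
    obtain n where "w = (f ^^ n) M \<or> w = (inv f ^^ n) M"
      using w by (auto simp: full_orbit_def)
    hence "(f ^^ 0) w = (f ^^ n) M \<or> (f ^^ n) w = (f ^^ 0) M" using rewind by auto
    thus ?thesis by blast
  qed
  obtain i j where ij: "(f ^^ i) u = (f ^^ j) M" using ahead[OF u] by blast
  obtain a b where ab: "(f ^^ a) v = (f ^^ b) M" using ahead[OF v] by blast
  have inj: "inj (f ^^ n)" for n using bij by (intro inj_fn bij_is_inj)
  have add: "(f ^^ (m + n)) z = (f ^^ m) ((f ^^ n) z)" for m n z by (simp add: funpow_add)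
  have eq: "(f ^^ (b + i)) u = (f ^^ (j + a)) v"
    unfolding add ij ab unfolding add[symmetric] by (simp only: add.commute)
  show thesis
  proof (cases "b + i \<le> j + a")
    case True
    hence "(f ^^ (b + i)) u = (f ^^ (b + i)) ((f ^^ (j + a - (b + i))) v)"
      using eq by (simp flip: add)
    thus thesis using injD[OF inj] that by blast
  next
    case False
    hence "(f ^^ (j + a)) v = (f ^^ (j + a)) ((f ^^ (b + i - (j + a))) u)"
      using eq by (simp flip: add)
    thus thesis using injD[OF inj] that by blast
  qed
qed

text \<open>
  If the iterates of both \<open>u\<close> and \<open>f\<^sup>n u\<close> under \<open>R\<close> tend to \<open>P\<close>, then by continuity
  \<open>f\<^sup>n P = P\<close>.  Taking the return map for \<open>R\<close> treats the points \<open>M\<^sup>+\<close>, and taking its inverse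
  the points \<open>M\<^sup>-\<close>.
\<close>

lemma stable_shift_period:
  fixes f :: "'a::t2_space \<Rightarrow> 'a"
  assumes cont: "continuous_on UNIV f" and per: "periodic_point f p P"
    and comm: "R \<circ> f = f \<circ> R"
    and u: "u \<in> stable_set R P" and v: "(f ^^ n) u \<in> stable_set R P"
  shows "p dvd n"
proof -
  have R: "R ((f ^^ n) z) = (f ^^ n) (R z)" for z n
    using comm by (induction n) (simp_all add: fun_eq_iff)
  have Rk: "(R ^^ k) ((f ^^ n) u) = (f ^^ n) ((R ^^ k) u)" for k by (induction k) (simp_all add: R)
  have lim: "(\<lambda>k. (f ^^ n) ((R ^^ k) u)) \<longlonglongrightarrow> (f ^^ n) P" for n
  proof (induction n)
    case 0
    thus ?case using u by (simp add: stable_set_def)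
  next
    case (Suc n)
    have "isCont f ((f ^^ n) P)" using cont by (simp add: continuous_on_eq_continuous_at)
    from isCont_tendsto_compose[OF this Suc] show ?case by simp
  qed
  have "(f ^^ n) P = P"
    using LIMSEQ_unique[OF lim[of n]] v by (simp add: stable_set_def Rk)
  hence "(f ^^ (n mod p)) P = P"
    using per by (metis funpow_mod_eq periodic_point_def)
  thus ?thesis using per by (auto simp: periodic_point_def dvd_eq_mod_eq_0)
qed


lemma continuous_funpow:
  fixes f :: "'a::topological_space \<Rightarrow> 'a"
  shows "continuous_on UNIV f \<Longrightarrow> continuous_on UNIV (f ^^ n)"
proof (induction n)
  case (Suc n)
  thus ?case using continuous_on_compose[of UNIV "f ^^ n" f] continuous_on_subset by auto
qed (simp add: id_def)

lemma same_orbit_by_return_map: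
  fixes f :: "'a::t2_space \<Rightarrow> 'a"
  assumes bij: "bij f" and cont: "continuous_on UNIV f" and per: "periodic_point f p P"
    and comm: "R \<circ> f = f \<circ> R"
    and u: "u \<in> full_orbit f M" "u \<in> stable_set R P" and v: "v \<in> full_orbit f M" "v \<in> stable_set R P"
  shows "\<exists>l. v = ((f ^^ p) ^^ l) u \<or> u = ((f ^^ p) ^^ l) v"
proof -
  obtain n where n: "v = (f ^^ n) u \<or> u = (f ^^ n) v" using full_orbit_linear[OF bij u(1) v(1)] .
  hence "p dvd n" using stable_shift_period[OF cont per comm] u(2) v(2) by blast
  thus ?thesis using n by (auto simp: dvd_def funpow_mult)
qed

lemma stable_periodic_imp_eq:
  fixes T :: "'a::t2_space \<Rightarrow> 'a"
  assumes z: "z \<in> stable_set T P" "(T ^^ d) z = z" "d > 0"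
  shows "z = P"
proof -
  have "((T ^^ d) ^^ k) z = z" for k by (induction k) (simp_all add: z(2))
  hence const: "(T ^^ (d * k)) z = z" for k by (simp add: funpow_mult)
  have "(\<lambda>n. (T ^^ n) z) \<longlonglongrightarrow> P" using z(1) by (simp add: stable_set_def)
  moreover have "strict_mono (\<lambda>k. d * k)" using z(3) by (simp add: strict_mono_def)
  ultimately have "((\<lambda>n. (T ^^ n) z) \<circ> (\<lambda>k. d * k)) \<longlonglongrightarrow> P" by (rule LIMSEQ_subseq_LIMSEQ)
  hence "(\<lambda>k::nat. z) \<longlonglongrightarrow> P" by (simp add: o_def const)
  thus ?thesis using LIMSEQ_unique tendsto_const by blast
qed

lemma iterates_at_orbit_unique:
  assumes a: "(f ^^ a) N = Q" and b: "(f ^^ b) N = Q" and Q: "\<And>d. d > 0 \<Longrightarrow> (f ^^ d) Q \<noteq> Q"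
  shows "a = b"
proof (rule ccontr)
  have *: False if "(f ^^ a) N = Q" "(f ^^ b) N = Q" "a < b" for a b
  proof -
    have "(f ^^ (b - a)) Q = (f ^^ (b - a + a)) N" using that(1) by (simp only: funpow_add o_apply)
    thus False using Q[of "b - a"] that by simp
  qed
  assume "a \<noteq> b"
  thus False using *[OF a b] *[OF b a] by linarith
qed

section \<open>Invariance under a change of the pair\<close>

context chart_near_saddle
begin

lemma point_jet_transport:
  assumes j: "point_jet \<phi> g M k" and g: "continuous_on UNIV g"
    and M: "M \<in> local_unstable_set T U P" and gM: "g M \<in> local_stable_set T U P" "\<phi> (g M) $ 2 = 0"
  shows "\<exists>k'. point_jet \<phi> ((T ^^ m) \<circ> g \<circ> (T ^^ n)) ((inv T ^^ n) M) k' \<and>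
     \<phi> ((T ^^ m) (g M)) $ 1 = lam ^ m * \<phi> (g M) $ 1 \<and>
     (co_c k' * \<phi> ((T ^^ m) (g M)) $ 1 = \<phi> ((inv T ^^ n) M) $ 2 \<longleftrightarrow> co_c k * \<phi> (g M) $ 1 = \<phi> M $ 2) \<and>
     (co_c k * \<phi> (g M) $ 1 = \<phi> M $ 2 \<longrightarrow>
        s0 (\<phi> ((T ^^ m) (g M)) $ 1) k' = s0 (\<phi> (g M) $ 1) k)"
proof -
  let ?N = "(inv T ^^ n) M" and ?h = "g \<circ> (T ^^ n)"
  have hN: "?h ?N = g M"
    using bij_T fn_o_inv_fn_is_id[of T n] by (metis comp_apply)
  have N: "?N \<in> U" "\<phi> ?N $ 1 = 0"
    using local_unstable_first_coord[OF local_unstable_backward[OF M]] local_unstable_backward[OF M]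
    by (force simp: local_unstable_set_def local_stable_set_def dest: spec[of _ 0])+
  have "isCont g ((T ^^ n) ?N)" using g by (simp add: continuous_on_eq_continuous_at)
  from isCont_o2[OF isCont_funpow_T this] have cont: "isCont ?h ?N" by (simp add: o_def)
  obtain k1 where k1: "point_jet \<phi> ?h ?N k1"
     "co_c k1 * \<phi> (g M) $ 1 = \<phi> ?N $ 2 \<longleftrightarrow> co_c k * \<phi> (g M) $ 1 = \<phi> M $ 2"
     "co_c k * \<phi> (g M) $ 1 = \<phi> M $ 2 \<longrightarrow> s0 (\<phi> (g M) $ 1) k1 = s0 (\<phi> (g M) $ 1) k"
    using point_jet_pre_iterate[OF j M] by blast
  have "(T ^^ i) (?h ?N) \<in> U" for i using gM(1) unfolding hN local_stable_set_def by simp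
  moreover have "\<phi> (?h ?N) $ 2 = 0" using gM(2) unfolding hN .
  ultimately obtain k2 where k2: "point_jet \<phi> ((T ^^ m) \<circ> ?h) ?N k2"
     "\<phi> ((T ^^ m) (g M)) $ 1 = lam ^ m * \<phi> (g M) $ 1"
     "s0 (\<phi> ((T ^^ m) (g M)) $ 1) k2 = s0 (\<phi> (g M) $ 1) k1"
     "co_c k2 * \<phi> ((T ^^ m) (g M)) $ 1 = co_c k1 * \<phi> (g M) $ 1"
    using point_jet_post_iterate[OF k1(1) N cont] unfolding hN by blast
  show ?thesis
    using k2(1,2) k1(2)[folded k2(4)] k1(3)[folded k2(3)] unfolding o_assoc by blast
qed

end

text \<open>
  The two pairs are moved to the common points \<open>Q\<close> and \<open>N\<close>.  There the jets coincide: two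
  different iterates of \<open>f\<close> from \<open>N\<close> to \<open>Q\<close> would make \<open>Q\<close> periodic, and a periodic point on
  the stable set is the saddle itself, whereas the first coordinate of \<open>Q\<close> is not zero.
\<close>

lemma s0_eq_of_balanced_pair:
  fixes f :: "'a::t2_space \<Rightarrow> 'a"
  assumes bij: "bij f" and cont: "continuous_on UNIV f" and per: "periodic_point f p P"
    and \<Gamma>: "\<Gamma> = full_orbit f M"
    and loc: "chart_near_saddle (f ^^ p) P U \<phi> lam gam \<beta>1 \<beta>2 \<beta>2' C"
    and pd1: "pair_data f p P \<Gamma> U \<phi> Mp1 Mm1 xp1 ym1 k1" and balanced: "co_c k1 * xp1 = ym1"
    and pd2: "pair_data f p P \<Gamma> U \<phi> Mp2 Mm2 xp2 ym2 k2"
  shows "s0 xp2 k2 = s0 xp1 k1"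
proof -
  define T where "T = f ^^ p"
  interpret chart_near_saddle T P U \<phi> lam gam \<beta>1 \<beta>2 \<beta>2' C using loc by (simp add: T_def)
  obtain q1 l1 where 1: "(f ^^ q1) Mm1 = Mp1"
    "Mp1 \<in> \<Gamma> \<inter> local_stable_set T U P" "Mm1 \<in> \<Gamma> \<inter> local_unstable_set T U P"
    "\<phi> Mp1 $ 1 \<noteq> 0" "\<phi> Mp1 $ 2 = 0" "\<phi> Mm1 $ 1 = 0" "point_jet \<phi> (f ^^ q1) Mm1 l1"
    "s0 (\<phi> Mp1 $ 1) l1 = s0 xp1 k1"
    "co_c l1 * \<phi> Mp1 $ 1 = \<phi> Mm1 $ 2 \<longleftrightarrow> co_c k1 * xp1 = ym1"
    using pair_data_imp_point_jet[OF pd1 chart] unfolding T_def by metis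
  obtain q2 l2 where 2: "(f ^^ q2) Mm2 = Mp2"
    "Mp2 \<in> \<Gamma> \<inter> local_stable_set T U P" "Mm2 \<in> \<Gamma> \<inter> local_unstable_set T U P"
    "\<phi> Mp2 $ 1 \<noteq> 0" "\<phi> Mp2 $ 2 = 0" "\<phi> Mm2 $ 1 = 0" "point_jet \<phi> (f ^^ q2) Mm2 l2"
    "s0 (\<phi> Mp2 $ 1) l2 = s0 xp2 k2"
    "co_c l2 * \<phi> Mp2 $ 1 = \<phi> Mm2 $ 2 \<longleftrightarrow> co_c k2 * xp2 = ym2"
    using pair_data_imp_point_jet[OF pd2 chart] unfolding T_def by metis
  have comm: "T \<circ> f = f \<circ> T" by (simp add: T_def fun_eq_iff funpow_swap1)
  have comm': "inv T \<circ> f = f \<circ> inv T"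
  proof
    fix z
    have "T (f (inv T z)) = f (T (inv T z))" using comm by (metis comp_apply)
    also have "T (inv T z) = z" using bij_T by (simp add: bij_is_surj surj_f_inv_f)
    finally show "(inv T \<circ> f) z = (f \<circ> inv T) z"
      using bij_T by (metis bij_inv_eq_iff comp_apply)
  qed
  obtain i1 i2 where i: "(T ^^ i1) Mp1 = (T ^^ i2) Mp2"
  proof -
    have "\<exists>l. Mp2 = (T ^^ l) Mp1 \<or> Mp1 = (T ^^ l) Mp2"
      unfolding T_def using 1(2) 2(2)
      by (intro same_orbit_by_return_map[OF bij cont per comm, where M = M])
         (auto simp: \<Gamma> local_stable_set_def)
    then obtain l where "(T ^^ 0) Mp2 = (T ^^ l) Mp1 \<or> (T ^^ 0) Mp1 = (T ^^ l) Mp2" by auto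
    thus thesis using that by metis
  qed
  obtain j1 j2 where j: "(inv T ^^ j1) Mm1 = (inv T ^^ j2) Mm2"
  proof -
    have "\<exists>l. Mm2 = (T ^^ l) Mm1 \<or> Mm1 = (T ^^ l) Mm2"
      unfolding T_def using 1(3) 2(3)
      by (intro same_orbit_by_return_map[OF bij cont per comm', where M = M])
         (auto simp: \<Gamma> local_unstable_set_def local_stable_set_def)
    then obtain l where "Mm2 = (T ^^ l) Mm1 \<or> Mm1 = (T ^^ l) Mm2" by blast
    moreover have "(inv T ^^ l) ((T ^^ l) z) = z" for z
      using bij_T inv_fn_o_fn_is_id[of T l] by (metis comp_apply)
    ultimately have "(inv T ^^ l) Mm2 = (inv T ^^ 0) Mm1 \<or> (inv T ^^ l) Mm1 = (inv T ^^ 0) Mm2" by auto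
    thus thesis using that by metis
  qed
  define N where "N = (inv T ^^ j1) Mm1"
  define Q where "Q = (T ^^ i1) Mp1"
  have cont_q: "continuous_on UNIV (f ^^ q)" for q using cont by (rule continuous_funpow)
  obtain l1' where t1: "point_jet \<phi> ((T ^^ i1) \<circ> (f ^^ q1) \<circ> (T ^^ j1)) N l1'"
     "\<phi> Q $ 1 = lam ^ i1 * \<phi> Mp1 $ 1"
     "co_c l1' * \<phi> Q $ 1 = \<phi> N $ 2 \<longleftrightarrow> co_c l1 * \<phi> Mp1 $ 1 = \<phi> Mm1 $ 2"
     "co_c l1 * \<phi> Mp1 $ 1 = \<phi> Mm1 $ 2 \<longrightarrow> s0 (\<phi> Q $ 1) l1' = s0 (\<phi> Mp1 $ 1) l1"
    using point_jet_transport[OF 1(7) cont_q, of i1 j1] 1(1-5) unfolding N_def Q_def by auto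
  obtain l2' where t2: "point_jet \<phi> ((T ^^ i2) \<circ> (f ^^ q2) \<circ> (T ^^ j2)) N l2'"
     "co_c l2' * \<phi> Q $ 1 = \<phi> N $ 2 \<longleftrightarrow> co_c l2 * \<phi> Mp2 $ 1 = \<phi> Mm2 $ 2"
     "co_c l2 * \<phi> Mp2 $ 1 = \<phi> Mm2 $ 2 \<longrightarrow> s0 (\<phi> Q $ 1) l2' = s0 (\<phi> Mp2 $ 1) l2"
    using point_jet_transport[OF 2(7) cont_q, of i2 j2] 2(1-5) unfolding N_def Q_def i j by auto
  have "(T ^^ n) ((inv T ^^ n) z) = z" for n z
    using bij_T fn_o_inv_fn_is_id[of T n] by (metis comp_apply)
  note T_inv = this
  have "((T ^^ i1) \<circ> (f ^^ q1) \<circ> (T ^^ j1)) N = Q"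
    using 1(1) by (simp add: N_def Q_def T_inv)
  moreover have "((T ^^ i2) \<circ> (f ^^ q2) \<circ> (T ^^ j2)) N = Q"
    using 2(1) by (simp add: N_def Q_def i j T_inv)
  ultimately have N: "((T ^^ i1) \<circ> (f ^^ q1) \<circ> (T ^^ j1)) N = Q"
    "((T ^^ i2) \<circ> (f ^^ q2) \<circ> (T ^^ j2)) N = Q" .
  have power: "(T ^^ i) \<circ> (f ^^ q) \<circ> (T ^^ j) = f ^^ (p * i + q + p * j)" for i q j
    by (simp add: T_def funpow_mult funpow_add)
  have aper: "(f ^^ d) Q \<noteq> Q" if "d > 0" for d
  proof
    assume "(f ^^ d) Q = Q"
    hence "((f ^^ d) ^^ p) Q = Q" by (induction p) simp_all
    hence "(T ^^ d) Q = Q" by (simp add: T_def funpow_mult mult.commute)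
    moreover have "Q \<in> stable_set T P"
    proof -
      have "(\<lambda>n. (T ^^ n) Mp1) \<longlonglongrightarrow> P"
        using 1(2) by (simp add: local_stable_set_def stable_set_def)
      from LIMSEQ_ignore_initial_segment[OF this, of i1]
      show ?thesis by (simp add: stable_set_def Q_def funpow_add)
    qed
    ultimately have "Q = P" using stable_periodic_imp_eq[OF _ _ that] by blast
    moreover have "lam \<noteq> 0" using lam_gam by auto
    ultimately show False using t1(2) 1(4) P(2) by simp
  qed
  have "p * i1 + q1 + p * j1 = p * i2 + q2 + p * j2"
    by (rule iterates_at_orbit_unique[OF N[unfolded power] aper])
  hence same: "(T ^^ i1) \<circ> (f ^^ q1) \<circ> (T ^^ j1) = (T ^^ i2) \<circ> (f ^^ q2) \<circ> (T ^^ j2)"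
    unfolding power by simp
  have "N \<in> local_unstable_set T U P"
    unfolding N_def using 1(3) by (intro local_unstable_backward) simp
  hence "N \<in> U" "\<phi> N $ 1 = 0"
    using local_unstable_first_coord
    by (force simp: local_unstable_set_def local_stable_set_def dest: spec[of _ 0])+
  hence "l1' = l2'" using t1(1) t2(1) unfolding same by (rule point_jet_unique)
  thus ?thesis using t1(3,4) t2(2,3) 1(8,9) 2(8) balanced by simp
qed

theorem lemma7:
  fixes A :: "'a::{t2_space, second_countable_topology} chart set"
    and f :: "'a \<Rightarrow> 'a" and P :: 'a and \<Gamma> U :: "'a set" and \<phi> :: "'a \<Rightarrow> real^2"
    and r m p :: nat and lam gam :: real
  assumes "3 \<le> r" and "area_atlas r A" and "area_preserving_map r A f"
    and "periodic_point f p P" and "saddle_fixed_point A (f ^^ p) P lam gam"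
    and "quadratic_homoclinic_orbit A f p P \<Gamma>"
    and "2 \<le> m" and "m \<le> r" and "area_chart m A (U, \<phi>)"
    and "(\<phi> ` U) homeomorphic (ball 0 1 :: (real^2) set)"
    and "second_order_normal_form (f ^^ p) P U \<phi> lam gam"
    and "\<exists>Mp Mm xp ym k. pair_data f p P \<Gamma> U \<phi> Mp Mm xp ym k \<and>
           (class_H31 lam gam k \<or> class_H34 lam gam k) \<and> tau lam xp ym k = 0"
    and "pair_data f p P \<Gamma> U \<phi> Mp1 Mm1 xp1 ym1 k1"
    and "pair_data f p P \<Gamma> U \<phi> Mp2 Mm2 xp2 ym2 k2"
  shows "s0 xp1 k1 = s0 xp2 k2"
proof -
  have f: "bij f" "continuous_on UNIV f" using assms(3) by (auto simp: area_preserving_map_def)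
  have lam: "0 < \<bar>lam\<bar>" "\<bar>lam\<bar> < 1" and gam: "gam \<noteq> 0"
    using assms(5) by (auto simp: saddle_fixed_point_def)
  obtain M where \<Gamma>: "\<Gamma> = full_orbit f M"
    using assms(6) by (auto simp: quadratic_homoclinic_orbit_def)
  obtain Mp Mm xp ym k where w: "pair_data f p P \<Gamma> U \<phi> Mp Mm xp ym k"
    and cls: "class_H31 lam gam k \<or> class_H34 lam gam k" and tau: "tau lam xp ym k = 0"
    using assms(12) by blast
  have pos: "xp > 0" "ym > 0" using w by (auto simp: pair_data_def homoclinic_pair_def)
  have lg: "lam = inverse gam" and c: "co_c k > 0"
    using cls by (auto simp: class_H31_def class_H34_def)
  have "ln \<bar>lam\<bar> < 0" using lam by simp
  hence "ln (co_c k * xp / ym) = 0" using tau pos c by (simp add: tau_def)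
  hence "co_c k * xp / ym = 1" using pos c by (subst (asm) ln_eq_zero_iff) auto
  hence balanced: "co_c k * xp = ym" using pos by simp
  obtain \<beta>1 \<beta>2 \<beta>2' C where nf: "P \<in> U" "\<phi> P = 0"
    "\<And>z. z \<in> U \<Longrightarrow> (f ^^ p) z \<in> U \<Longrightarrow> normal_form_bounds lam gam \<beta>1 \<beta>2 \<beta>2' C
       (\<phi> z $ 1) (\<phi> z $ 2) (\<phi> ((f ^^ p) z) $ 1) (\<phi> ((f ^^ p) z) $ 2)"
    using assms(11) unfolding second_order_normal_form_def normal_form_bounds_def Let_def by blast
  have loc: "chart_near_saddle (f ^^ p) P U \<phi> lam gam \<beta>1 \<beta>2 \<beta>2' C"
  proof
    show "bij (f ^^ p)" using f(1) by (rule bij_fn)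
    show "continuous_on UNIV (f ^^ p)" using f(2) by (rule continuous_funpow)
    show "is_chart (U, \<phi>)" using assms(9) by (simp add: area_chart_def)
    show "lam * gam = 1" using lg gam by simp
  qed (use nf lam in auto)
  note eq = s0_eq_of_balanced_pair[OF f assms(4) \<Gamma> loc w balanced]
  show ?thesis using eq[OF assms(13)] eq[OF assms(14)] by simp
qed

end
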